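(* Let $(\mathcal M,\delta)\models T_g^\delta$. Let $C\subseteq M^k$ be a sufficiently smooth $\delta$-cell, and let $\varphi$ and $\psi$ be minimal source formulas for $C$. Write $n=\operatorname{ord}(\varphi)=\operatorname{ord}(\psi)$. Then $$C_\varphi^{\mathcal L}=C_\psi^{\mathcal L}\subseteq E_n.$$ Moreover, if the corresponding minimal layouts are prepared, then they determine the same lower configurations and the same extended configurations. Hence the complete configuration of $C$ is independent of the chosen minimal prepared source layout.
   Context: $T$ is a complete o-minimal theory expanding the theory of real closed ordered fields in a language $\mathcal L$, with quantifier elimination and universally axiomatizable. $\mathcal L^\delta=\mathcal L\cup\{\delta\}$. A $T$-derivation on $\mathcal M\models T$ is a map $\delta:M\to M$ with $\delta f(u)=\mathbf J_f(u)\,\delta u$ for every $\mathcal L(\varnothing)$-definable $\mathcal C^1$-function $f:U\to M$, $U\subseteq M^n$ open, $u\in U$. $T_g^\delta$ is the theory of $(\mathcal M,\delta)$ with $\mathcal M\models T$ and $\delta$ a $T$-derivation that is generic: for every $\mathcal L(M)$-definable $A\subseteq M^{n+1}$ whose projection to the first $n$ coordinates has dimension $n$, there is $a\in M$ with $(a,\delta a,\ldots,\delta^na)\in A$. Jets: for $n\in\mathbb N^k$, $E_n=\prod_{i=1}^kM^{n_i+1}$ with coordinates $x_i^{(j)}$, $0\le j\le n_i$ (the $i$-th block), and $\operatorname{Jet}_n(a)=(a_i,\delta a_i,\ldots,\delta^{n_i}a_i)_{1\le i\le k}$. For $m\le n$ coordinatewise, $\Pi_m:E_n\to E_m$ forgets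 the derivatives of order $>m_i$ in block $i$. For $r\in\mathbb N$, $n+r=(n_1+r,\ldots,n_k+r)$. Source formulas: for a quantifier-free $\mathcal L^\delta(M)$-formula $\varphi(x_1,\ldots,x_k)$ (with $\delta$ applied to variables as $\delta^jx_i$), $\operatorname{ord}(\varphi)=(n_1,\ldots,n_k)$, $n_i$ the largest order of a derivative of $x_i$ occurring (0 if none). If $\varphi$ defines $C$, $C_\varphi^{\mathcal L}\subseteq E_n$ is defined by replacing $\delta^jx_i$ by $x_i^{(j)}$. $\varphi$ is a source formula for $C$ if it defines $C$, $C_\varphi^{\mathcal L}$ is an o-minimal cell, and $\operatorname{Jet}_n(C)$ is dense in $C_\varphi^{\mathcal L}$ (the source cell). A $\delta$-cell is a set admitting a source formula. Order $\mathbb N^k$ by reverse lexicographic order: $m\prec_{\mathrm{rlex}}n$ if $m_i<n_i$ at the largest index $i$ with $m_i\ne n_i$. A source formula is minimal if its order is $\prec_{\mathrm{rlex}}$-minimal among all source formulas for $C$. Layouts: let $D=C_\varphi^{\mathcal L}$, and for $1\le i\le k$, $0\le j\le n_i+1$ let $\rho_{i,j}$ be the projection of $E_n$ keeping all coordinates of the first $i-1$ blocks and the first $j$ coordinates of block $i$. The layout of $C$ with respect to $\varphi$ is the family of pairs $(f_{i,j,0},f_{i,j,1})$ ($1\le i\le k$, $0\le j\le n_i$) such that $\rho_{i,j+1}(D)$ is either the graph of $f_{i,j,0}=f_{i,j,1}:\rho_{i,j}(D)\to M$, or the band between $f_{i,j,0}<f_{i,j,1}$ over $\rho_{i,j}(D)$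 (values $\pm\infty$ allowed). The pair is the $j$-th layer of block $i$. A block is prepared if there is $0\le n_i'\le n_i+1$ with layers $j<n_i'$ bands and layers $n_i'\le j\le n_i$ graphs; the layout is prepared if all blocks are. A minimal layout is the layout of a minimal source formula; a source layout is a minimal prepared layout. Operator $\mathcal S$: for a $\mathcal C^1$ $\mathcal L(M)$-definable $f:U\to M$, $U$ open in a jet space, there is a unique $\mathcal L(M)$-definable continuous $f^{[\delta]}:U\to M$ with $\delta f(u)=f^{[\delta]}(u)+\mathbf J_f(u)\delta u$ for all $u\in U$; $\mathcal S(f)$ is the function obtained from $f^{[\delta]}(u)+\mathbf J_f(u)\cdot v$ by taking for $v$ the tuple in which the entry corresponding to a coordinate $x_h^{(r)}$ is the next jet coordinate $x_h^{(r+1)}$. For $f$ on a non-open cell (of class $\mathcal C^1$, i.e. with a definable $\mathcal C^1$ extension $F$ to an open neighbourhood), $\mathcal S(f)$ is the restriction of $\mathcal S(F)$ to the relevant cell at the next jet level. Configurations: for a source layout of order $n$ with source cell $D$, the lower configurations are $C_m=\Pi_m(D)$ for $m\le n$. The layout is extended from order $n+r$ to $n+r+1$ by adding to each block $i$ one layer: if the last layer of block $i$ is the graph of $f$, the new layer is the graph of $\mathcal S(f)$; if it is a band, the new layer is the full band $(-\infty,+\infty)$. The extended configuration $C_{n+r}\subseteq E_{n+r}$ is the cell defined by the extended layout (for all $r\in\mathbb N$ with $r\le p$ if the source cell is of class $\mathcal C^p$). The complete configuration is the family of lower and extended configurations. "Sufficiently smooth" means that the source cells under consideration are of class $\mathcal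 C^r$ with $r$ large enough (depending only on the order) for all the applications of $\mathcal S$ involved. *)

theory Defs
  imports
    "HOL-Analysis.Analysis"
    "HOL-Algebra.Ring"
    "HOL-Library.Extended"
begin

section \<open>First-order logic\<close>

datatype ('f, 'v) fo_term = Var 'v | Fn 'f "('f, 'v) fo_term list"

datatype ('f, 'r, 'v) fo_form =
    Equ "('f, 'v) fo_term" "('f, 'v) fo_term"
  | Rel 'r "('f, 'v) fo_term list"
  | Neg "('f, 'r, 'v) fo_form"
  | Conj "('f, 'r, 'v) fo_form" "('f, 'r, 'v) fo_form"
  | Disj "('f, 'r, 'v) fo_form" "('f, 'r, 'v) fo_form"
  | Forall 'v "('f, 'r, 'v) fo_form"
  | Exists 'v "('f, 'r, 'v) fo_form"

record ('f, 'r) fo_sig =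
  farity :: "'f \<Rightarrow> nat"
  rarity :: "'r \<Rightarrow> nat"

record ('f, 'r, 'a) fo_struct =
  dom :: "'a set"
  fint :: "'f \<Rightarrow> 'a list \<Rightarrow> 'a"
  rint :: "'r \<Rightarrow> 'a list \<Rightarrow> bool"

fun term_vars :: "('f, 'v) fo_term \<Rightarrow> 'v set" where
  "term_vars (Var x) = {x}"
| "term_vars (Fn f ts) = (\<Union>t\<in>set ts. term_vars t)"

primrec free_vars :: "('f, 'r, 'v) fo_form \<Rightarrow> 'v set" where
  "free_vars (Equ s t) = term_vars s \<union> term_vars t"
| "free_vars (Rel r ts) = (\<Union>t\<in>set ts. term_vars t)"
| "free_vars (Neg \<phi>) = free_vars \<phi>"
| "free_vars (Conj \<phi> \<psi>) = free_vars \<phi> \<union> free_vars \<psi>"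
| "free_vars (Disj \<phi> \<psi>) = free_vars \<phi> \<union> free_vars \<psi>"
| "free_vars (Forall x \<phi>) = free_vars \<phi> - {x}"
| "free_vars (Exists x \<phi>) = free_vars \<phi> - {x}"

fun wf_term :: "('f, 'r, 'z) fo_sig_scheme \<Rightarrow> ('f, 'v) fo_term \<Rightarrow> bool" where
  "wf_term L (Var x) \<longleftrightarrow> True"
| "wf_term L (Fn f ts) \<longleftrightarrow> length ts = farity L f \<and> (\<forall>t\<in>set ts. wf_term L t)"

primrec wf_form :: "('f, 'r, 'z) fo_sig_scheme \<Rightarrow> ('f, 'r, 'v) fo_form \<Rightarrow> bool" where
  "wf_form L (Equ s t) \<longleftrightarrow> wf_term L s \<and> wf_term L t"
| "wf_form L (Rel r ts) \<longleftrightarrow> length ts = rarity L r \<and> (\<forall>t\<in>set ts. wf_term L t)"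
| "wf_form L (Neg \<phi>) \<longleftrightarrow> wf_form L \<phi>"
| "wf_form L (Conj \<phi> \<psi>) \<longleftrightarrow> wf_form L \<phi> \<and> wf_form L \<psi>"
| "wf_form L (Disj \<phi> \<psi>) \<longleftrightarrow> wf_form L \<phi> \<and> wf_form L \<psi>"
| "wf_form L (Forall x \<phi>) \<longleftrightarrow> wf_form L \<phi>"
| "wf_form L (Exists x \<phi>) \<longleftrightarrow> wf_form L \<phi>"

primrec qfree :: "('f, 'r, 'v) fo_form \<Rightarrow> bool" where
  "qfree (Equ s t) \<longleftrightarrow> True"
| "qfree (Rel r ts) \<longleftrightarrow> True"
| "qfree (Neg \<phi>) \<longleftrightarrow> qfree \<phi>"
| "qfree (Conj \<phi> \<psi>) \<longleftrightarrow> qfree \<phi> \<and> qfree \<psi>"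
| "qfree (Disj \<phi> \<psi>) \<longleftrightarrow> qfree \<phi> \<and> qfree \<psi>"
| "qfree (Forall x \<phi>) \<longleftrightarrow> False"
| "qfree (Exists x \<phi>) \<longleftrightarrow> False"

inductive universal :: "('f, 'r, 'v) fo_form \<Rightarrow> bool" where
  "qfree \<phi> \<Longrightarrow> universal \<phi>"
| "universal \<phi> \<Longrightarrow> universal (Forall x \<phi>)"

definition sentence :: "('f, 'r, 'z) fo_sig_scheme \<Rightarrow> ('f, 'r, 'v) fo_form \<Rightarrow> bool" where
  "sentence L \<sigma> \<longleftrightarrow> wf_form L \<sigma> \<and> free_vars \<sigma> = {}"

fun val :: "('f, 'r, 'a, 'z) fo_struct_scheme \<Rightarrow> ('v \<Rightarrow> 'a) \<Rightarrow> ('f, 'v) fo_term \<Rightarrow> 'a" where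
  "val N v (Var x) = v x"
| "val N v (Fn f ts) = fint N f (map (val N v) ts)"

primrec sat :: "('f, 'r, 'a, 'z) fo_struct_scheme \<Rightarrow> ('v \<Rightarrow> 'a) \<Rightarrow> ('f, 'r, 'v) fo_form \<Rightarrow> bool" where
  "sat N v (Equ s t) \<longleftrightarrow> val N v s = val N v t"
| "sat N v (Rel r ts) \<longleftrightarrow> rint N r (map (val N v) ts)"
| "sat N v (Neg \<phi>) \<longleftrightarrow> \<not> sat N v \<phi>"
| "sat N v (Conj \<phi> \<psi>) \<longleftrightarrow> sat N v \<phi> \<and> sat N v \<psi>"
| "sat N v (Disj \<phi> \<psi>) \<longleftrightarrow> sat N v \<phi> \<or> sat N v \<psi>"
| "sat N v (Forall x \<phi>) \<longleftrightarrow> (\<forall>b\<in>dom N. sat N (v(x := b)) \<phi>)"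
| "sat N v (Exists x \<phi>) \<longleftrightarrow> (\<exists>b\<in>dom N. sat N (v(x := b)) \<phi>)"

definition is_struct :: "('f, 'r, 'z) fo_sig_scheme \<Rightarrow> ('f, 'r, 'a) fo_struct \<Rightarrow> bool" where
  "is_struct L N \<longleftrightarrow> dom N \<noteq> {} \<and>
     (\<forall>f as. length as = farity L f \<longrightarrow> set as \<subseteq> dom N \<longrightarrow> fint N f as \<in> dom N)"

definition models ::
  "('f, 'r, 'z) fo_sig_scheme \<Rightarrow> ('f, 'r, 'a) fo_struct \<Rightarrow> ('f, 'r, nat) fo_form set \<Rightarrow> bool" where
  "models L N T \<longleftrightarrow> is_struct L N \<and> (\<forall>\<sigma>\<in>T. \<forall>v. range v \<subseteq> dom N \<longrightarrow> sat N v \<sigma>)"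

text \<open>
  HOL cannot quantify over the universe types of all models of a theory.  Properties that refer
  to all models are stated for models whose universe is a subset of one type, the type of
  formulas.  Its cardinality is \<open>|L| + \<aleph>\<^sub>0\<close>, so by Loewenheim-Skolem these models
  decide consequence, equivalence of theories, and o-minimality of all models.
\<close>

type_synonym ('f, 'r) small_struct = "('f, 'r, ('f, 'r, nat) fo_form) fo_struct"

definition entails ::
  "('f, 'r, 'z) fo_sig_scheme \<Rightarrow> ('f, 'r, nat) fo_form set \<Rightarrow> ('f, 'r, nat) fo_form \<Rightarrow> bool" where
  "entails L T \<sigma> \<longleftrightarrow> (\<forall>N :: ('f, 'r) small_struct. models L N T \<longrightarrow>
     (\<forall>v. range v \<subseteq> dom N \<longrightarrow> sat N v \<sigma>))"

definition complete_theory ::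
  "('f, 'r, 'z) fo_sig_scheme \<Rightarrow> ('f, 'r, nat) fo_form set \<Rightarrow> bool" where
  "complete_theory L T \<longleftrightarrow>
     (\<exists>N :: ('f, 'r) small_struct. models L N T) \<and>
     (\<forall>\<sigma>. sentence L \<sigma> \<longrightarrow> entails L T \<sigma> \<or> entails L T (Neg \<sigma>))"

definition quantifier_elimination ::
  "('f, 'r, 'z) fo_sig_scheme \<Rightarrow> ('f, 'r, nat) fo_form set \<Rightarrow> bool" where
  "quantifier_elimination L T \<longleftrightarrow> (\<forall>\<phi> :: ('f, 'r, nat) fo_form. wf_form L \<phi> \<longrightarrow>
     (\<exists>\<psi>. wf_form L \<psi> \<and> qfree \<psi> \<and> free_vars \<psi> \<subseteq> free_vars \<phi> \<and>
       (\<forall>N :: ('f, 'r) small_struct. models L N T \<longrightarrow>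
         (\<forall>v. range v \<subseteq> dom N \<longrightarrow> sat N v \<phi> = sat N v \<psi>))))"

definition universally_axiomatizable ::
  "('f, 'r, 'z) fo_sig_scheme \<Rightarrow> ('f, 'r, nat) fo_form set \<Rightarrow> bool" where
  "universally_axiomatizable L T \<longleftrightarrow>
     (\<exists>T'. (\<forall>\<sigma>\<in>T'. sentence L \<sigma> \<and> universal \<sigma>) \<and>
       (\<forall>N :: ('f, 'r) small_struct. models L N T \<longleftrightarrow> models L N T'))"

text \<open>
  Points of a power \<open>N\<^sup>I\<close> are extensional functions on the index set \<open>I\<close>.  The variables of a
  formula defining a subset of \<open>N\<^sup>I\<close> are the elements of \<open>I\<close>.
\<close>

definition definable_set ::
  "('f, 'r, 'z) fo_sig_scheme \<Rightarrow> ('f, 'r, 'a) fo_struct \<Rightarrow> 'v set \<Rightarrow> ('v \<Rightarrow> 'a) set \<Rightarrow> bool" where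
  "definable_set L N I X \<longleftrightarrow> (\<exists>\<phi>. wf_form L \<phi> \<and> free_vars \<phi> \<subseteq> I \<and>
     X = {x \<in> I \<rightarrow>\<^sub>E dom N. sat N x \<phi>})"

definition definable_fun ::
  "('f, 'r, 'z) fo_sig_scheme \<Rightarrow> ('f, 'r, 'a) fo_struct \<Rightarrow> 'v set \<Rightarrow> ('v \<Rightarrow> 'a) set \<Rightarrow>
     (('v \<Rightarrow> 'a) \<Rightarrow> 'a) \<Rightarrow> bool" where
  "definable_fun L N I U f \<longleftrightarrow> U \<subseteq> I \<rightarrow>\<^sub>E dom N \<and> f ` U \<subseteq> dom N \<and>
     (\<exists>\<phi> y. wf_form L \<phi> \<and> y \<notin> I \<and> free_vars \<phi> \<subseteq> insert y I \<and>
       (\<forall>x\<in>I \<rightarrow>\<^sub>E dom N. \<forall>b\<in>dom N. sat N (x(y := b)) \<phi> \<longleftrightarrow> x \<in> U \<and> b = f x))"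

text \<open>The expansion of the language and of the structure by constants for all elements.\<close>

definition par_sig :: "('f, 'r, 'z) fo_sig_scheme \<Rightarrow> ('f + 'a, 'r) fo_sig" where
  "par_sig L = \<lparr>farity = case_sum (farity L) (\<lambda>_. 0), rarity = rarity L\<rparr>"

definition par_struct :: "('f, 'r, 'a) fo_struct \<Rightarrow> ('f + 'a, 'r, 'a) fo_struct" where
  "par_struct N = \<lparr>dom = dom N, fint = case_sum (fint N) (\<lambda>c _. c), rint = rint N\<rparr>"


section \<open>O-minimal theories of real closed fields\<close>

record ('f, 'r) of_sig = "('f, 'r) fo_sig" +
  zero_sym :: 'f
  one_sym :: 'f
  plus_sym :: 'f
  minus_sym :: 'f
  times_sym :: 'f
  less_sym :: 'r

text \<open>The symbol \<open>minus_sym\<close> is unary.\<close>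

definition expands_ordered_fields :: "('f, 'r) of_sig \<Rightarrow> bool" where
  "expands_ordered_fields L \<longleftrightarrow>
     distinct [zero_sym L, one_sym L, plus_sym L, minus_sym L, times_sym L] \<and>
     farity L (zero_sym L) = 0 \<and> farity L (one_sym L) = 0 \<and> farity L (plus_sym L) = 2 \<and>
     farity L (minus_sym L) = 1 \<and> farity L (times_sym L) = 2 \<and> rarity L (less_sym L) = 2"

definition ring_reduct :: "('f, 'r) of_sig \<Rightarrow> ('f, 'r, 'a) fo_struct \<Rightarrow> 'a ring" where
  "ring_reduct L N = \<lparr>carrier = dom N, monoid.mult = (\<lambda>a b. fint N (times_sym L) [a, b]),
     one = fint N (one_sym L) [], ring.zero = fint N (zero_sym L) [],
     add = (\<lambda>a b. fint N (plus_sym L) [a, b])\<rparr>"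

definition less_of :: "('f, 'r) of_sig \<Rightarrow> ('f, 'r, 'a) fo_struct \<Rightarrow> 'a \<Rightarrow> 'a \<Rightarrow> bool" where
  "less_of L N a b \<longleftrightarrow> rint N (less_sym L) [a, b]"

definition real_closed_ordered_field ::
  "('f, 'r) of_sig \<Rightarrow> ('f, 'r, 'a) fo_struct \<Rightarrow> bool" where
  "real_closed_ordered_field L N \<longleftrightarrow>
     (let R = ring_reduct L N; lt = less_of L N in
       Ring.field R \<and>
       (\<forall>a\<in>dom N. a \<oplus>\<^bsub>R\<^esub> fint N (minus_sym L) [a] = \<zero>\<^bsub>R\<^esub>) \<and>
       (\<forall>a\<in>dom N. \<not> lt a a) \<and>
       (\<forall>a\<in>dom N. \<forall>b\<in>dom N. \<forall>c\<in>dom N. lt a b \<longrightarrow> lt b c \<longrightarrow> lt a c) \<and>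
       (\<forall>a\<in>dom N. \<forall>b\<in>dom N. lt a b \<or> a = b \<or> lt b a) \<and>
       (\<forall>a\<in>dom N. \<forall>b\<in>dom N. \<forall>c\<in>dom N. lt a b \<longrightarrow> lt (a \<oplus>\<^bsub>R\<^esub> c) (b \<oplus>\<^bsub>R\<^esub> c)) \<and>
       (\<forall>a\<in>dom N. \<forall>b\<in>dom N. lt \<zero>\<^bsub>R\<^esub> a \<longrightarrow> lt \<zero>\<^bsub>R\<^esub> b \<longrightarrow> lt \<zero>\<^bsub>R\<^esub> (a \<otimes>\<^bsub>R\<^esub> b)) \<and>
       (\<forall>a\<in>dom N. lt \<zero>\<^bsub>R\<^esub> a \<longrightarrow> (\<exists>b\<in>dom N. a = b \<otimes>\<^bsub>R\<^esub> b)) \<and>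
       (\<forall>d. \<forall>c\<in>{..d} \<rightarrow> dom N. odd d \<longrightarrow> c d \<noteq> \<zero>\<^bsub>R\<^esub> \<longrightarrow>
         (\<exists>b\<in>dom N. (\<Oplus>\<^bsub>R\<^esub>i\<in>{..d::nat}. c i \<otimes>\<^bsub>R\<^esub> b [^]\<^bsub>R\<^esub> i) = \<zero>\<^bsub>R\<^esub>)))"

definition point_or_interval ::
  "('f, 'r) of_sig \<Rightarrow> ('f, 'r, 'a) fo_struct \<Rightarrow> 'a set \<Rightarrow> bool" where
  "point_or_interval L N Y \<longleftrightarrow>
     (\<exists>a\<in>dom N. Y = {a}) \<or>
     (\<exists>l u :: 'a option. set_option l \<union> set_option u \<subseteq> dom N \<and>
       Y = {b \<in> dom N. (\<forall>a\<in>set_option l. less_of L N a b) \<and> (\<forall>c\<in>set_option u. less_of L N b c)})"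

definition o_minimal :: "('f, 'r) of_sig \<Rightarrow> ('f, 'r, 'a) fo_struct \<Rightarrow> bool" where
  "o_minimal L N \<longleftrightarrow>
     (\<forall>X. definable_set (par_sig L) (par_struct N) {0::nat} X \<longrightarrow>
       (\<exists>\<F>. finite \<F> \<and> (\<forall>Y\<in>\<F>. point_or_interval L N Y) \<and> (\<lambda>x. x 0) ` X = \<Union>\<F>))"

definition o_minimal_theory :: "('f, 'r) of_sig \<Rightarrow> ('f, 'r, nat) fo_form set \<Rightarrow> bool" where
  "o_minimal_theory L T \<longleftrightarrow>
     (\<forall>\<sigma>\<in>T. sentence L \<sigma>) \<and> complete_theory L T \<and>
     expands_ordered_fields L \<and>
     (\<forall>N :: ('f, 'r) small_struct. models L N T \<longrightarrow>
        real_closed_ordered_field L N \<and> o_minimal L N) \<and>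
     quantifier_elimination L T \<and> universally_axiomatizable L T"

text \<open>
  The distinguished model has a whole type as its universe.  The type is an ordered field with
  its order topology, and the symbols of ordered fields are interpreted by its operations.
\<close>

definition standard_model ::
  "('f, 'r) of_sig \<Rightarrow> ('f, 'r, nat) fo_form set \<Rightarrow>
     ('f, 'r, 'a::{linordered_field, linorder_topology}) fo_struct \<Rightarrow> bool" where
  "standard_model L T M \<longleftrightarrow> models L M T \<and> dom M = UNIV \<and>
     fint M (zero_sym L) [] = 0 \<and> fint M (one_sym L) [] = 1 \<and>
     (\<forall>a b. fint M (plus_sym L) [a, b] = a + b) \<and>
     (\<forall>a. fint M (minus_sym L) [a] = - a) \<and>
     (\<forall>a b. fint M (times_sym L) [a, b] = a * b) \<and>
     (\<forall>a b. rint M (less_sym L) [a, b] \<longleftrightarrow> a < b)"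


section \<open>Differentiable functions, cells and dimension\<close>

text \<open>
  The topology on functions is the product topology, so the subspace topology on \<open>M\<^sup>I\<close> for
  finite \<open>I\<close> is the usual one.  The library derivatives need a real normed space, hence partial
  derivatives are taken here over the ordered field itself.
\<close>

abbreviation cart_power :: "'v set \<Rightarrow> ('v \<Rightarrow> 'a) set" where
  "cart_power I \<equiv> I \<rightarrow>\<^sub>E UNIV"

definition open_in_power :: "'v set \<Rightarrow> ('v \<Rightarrow> 'a::topological_space) set \<Rightarrow> bool" where
  "open_in_power I U \<longleftrightarrow> openin (top_of_set (cart_power I)) U"

definition diff_quotient ::
  "(('v \<Rightarrow> 'a::linordered_field) \<Rightarrow> 'a) \<Rightarrow> ('v \<Rightarrow> 'a) \<Rightarrow> 'v \<Rightarrow> 'a \<Rightarrow> 'a" where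
  "diff_quotient f u c t = (f (u(c := u c + t)) - f u) / t"

definition partial_deriv ::
  "'v \<Rightarrow> (('v \<Rightarrow> 'a::{linordered_field, linorder_topology}) \<Rightarrow> 'a) \<Rightarrow> ('v \<Rightarrow> 'a) \<Rightarrow> 'a" where
  "partial_deriv c f u = Lim (at 0) (diff_quotient f u c)"

definition jacobian ::
  "'v set \<Rightarrow> (('v \<Rightarrow> 'a::{linordered_field, linorder_topology}) \<Rightarrow> 'a) \<Rightarrow> ('v \<Rightarrow> 'a) \<Rightarrow>
     ('v \<Rightarrow> 'a) \<Rightarrow> 'a" where
  "jacobian I f u v = (\<Sum>c\<in>I. partial_deriv c f u * v c)"

text \<open>\<open>C_on p I U f\<close>: the function \<open>f\<close> is of class \<open>C\<^sup>p\<close> on the open set \<open>U\<close> of \<open>M\<^sup>I\<close>.\<close>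

primrec C_on ::
  "nat \<Rightarrow> 'v set \<Rightarrow> ('v \<Rightarrow> 'a) set \<Rightarrow>
     (('v \<Rightarrow> 'a::{linordered_field, linorder_topology}) \<Rightarrow> 'a) \<Rightarrow> bool" where
  "C_on 0 I U f \<longleftrightarrow> continuous_on U f"
| "C_on (Suc p) I U f \<longleftrightarrow> continuous_on U f \<and>
     (\<forall>c\<in>I. (\<forall>u\<in>U. \<exists>d. (diff_quotient f u c \<longlongrightarrow> d) (at 0)) \<and> C_on p I U (partial_deriv c f))"

definition Cp_extension ::
  "('f, 'r, 'z) fo_sig_scheme \<Rightarrow> ('f, 'r, 'a::{linordered_field, linorder_topology}) fo_struct \<Rightarrow>
     nat \<Rightarrow> 'v set \<Rightarrow> ('v \<Rightarrow> 'a) set \<Rightarrow> (('v \<Rightarrow> 'a) \<Rightarrow> 'a) \<Rightarrow>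
     ('v \<Rightarrow> 'a) set \<Rightarrow> (('v \<Rightarrow> 'a) \<Rightarrow> 'a) \<Rightarrow> bool" where
  "Cp_extension L M p I B f U F \<longleftrightarrow>
     open_in_power I U \<and> B \<subseteq> U \<and> definable_fun (par_sig L) (par_struct M) I U F \<and>
     C_on p I U F \<and> (\<forall>x\<in>B. F x = f x)"

definition class_C ::
  "('f, 'r, 'z) fo_sig_scheme \<Rightarrow> ('f, 'r, 'a::{linordered_field, linorder_topology}) fo_struct \<Rightarrow>
     nat \<Rightarrow> 'v set \<Rightarrow> ('v \<Rightarrow> 'a) set \<Rightarrow> (('v \<Rightarrow> 'a) \<Rightarrow> 'a) \<Rightarrow> bool" where
  "class_C L M p I B f \<longleftrightarrow>
     definable_fun (par_sig L) (par_struct M) I B f \<and> continuous_on B f \<and>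
     (0 < p \<longrightarrow> (\<exists>U F. Cp_extension L M p I B f U F))"

text \<open>
  A layer over a base \<open>B\<close>.  \<open>Graph f\<close> stands for the pair \<open>(f, f)\<close>, and \<open>Band f g\<close> for a pair
  \<open>(f, g)\<close> with \<open>f < g\<close> on \<open>B\<close>.
\<close>

datatype ('p, 'a) layer = Graph "'p \<Rightarrow> 'a" | Band "'p \<Rightarrow> 'a extended" "'p \<Rightarrow> 'a extended"

fun in_layer :: "('p, 'a::linorder) layer \<Rightarrow> 'p \<Rightarrow> 'a \<Rightarrow> bool" where
  "in_layer (Graph f) x b \<longleftrightarrow> b = f x"
| "in_layer (Band f g) x b \<longleftrightarrow> f x < Fin b \<and> Fin b < g x"

fun valid_layer :: "'p set \<Rightarrow> ('p, 'a::linorder) layer \<Rightarrow> bool" where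
  "valid_layer B (Graph f) \<longleftrightarrow> True"
| "valid_layer B (Band f g) \<longleftrightarrow> (\<forall>x\<in>B. f x < g x)"

fun is_graph :: "('p, 'a) layer \<Rightarrow> bool" where
  "is_graph (Graph f) \<longleftrightarrow> True"
| "is_graph (Band f g) \<longleftrightarrow> False"

definition over :: "('v \<Rightarrow> 'a) set \<Rightarrow> 'v \<Rightarrow> ('v \<Rightarrow> 'a, 'a::linorder) layer \<Rightarrow> ('v \<Rightarrow> 'a) set" where
  "over B c \<Lambda> = {x(c := b) | x b. x \<in> B \<and> in_layer \<Lambda> x b}"

definition bound_of_class ::
  "('f, 'r, 'z) fo_sig_scheme \<Rightarrow> ('f, 'r, 'a::{linordered_field, linorder_topology}) fo_struct \<Rightarrow>
     nat \<Rightarrow> 'v set \<Rightarrow> ('v \<Rightarrow> 'a) set \<Rightarrow> (('v \<Rightarrow> 'a) \<Rightarrow> 'a extended) \<Rightarrow> bool" where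
  "bound_of_class L M p I B f \<longleftrightarrow>
     (\<forall>x\<in>B. f x = Minf) \<or> (\<forall>x\<in>B. f x = Pinf) \<or>
     (\<exists>h. class_C L M p I B h \<and> (\<forall>x\<in>B. f x = Fin (h x)))"

fun layer_of_class ::
  "('f, 'r, 'z) fo_sig_scheme \<Rightarrow> ('f, 'r, 'a::{linordered_field, linorder_topology}) fo_struct \<Rightarrow>
     nat \<Rightarrow> 'v set \<Rightarrow> ('v \<Rightarrow> 'a) set \<Rightarrow> ('v \<Rightarrow> 'a, 'a) layer \<Rightarrow> bool" where
  "layer_of_class L M p I B (Graph f) \<longleftrightarrow> class_C L M p I B f"
| "layer_of_class L M p I B (Band f g) \<longleftrightarrow>
     bound_of_class L M p I B f \<and> bound_of_class L M p I B g"

text \<open>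
  \<open>cell L M p cs ds X\<close>: in the power of \<open>M\<close> whose coordinates are, in this order, the list
  \<open>cs\<close>, the set \<open>X\<close> is a \<open>ds\<close>-cell of class \<open>C\<^sup>p\<close>.  Ordinary o-minimal cells are those of
  class \<open>C\<^sup>0\<close>.
\<close>

inductive cell ::
  "('f, 'r, 'z) fo_sig_scheme \<Rightarrow> ('f, 'r, 'a::{linordered_field, linorder_topology}) fo_struct \<Rightarrow>
     nat \<Rightarrow> 'v list \<Rightarrow> nat list \<Rightarrow> ('v \<Rightarrow> 'a) set \<Rightarrow> bool"
  for L M p where
  "cell L M p [] [] {\<lambda>_. undefined}"
| "\<lbrakk>cell L M p cs ds B; c \<notin> set cs; valid_layer B \<Lambda>; layer_of_class L M p (set cs) B \<Lambda>\<rbrakk> \<Longrightarrow>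
     cell L M p (cs @ [c]) (ds @ [if is_graph \<Lambda> then 0 else 1]) (over B c \<Lambda>)"

definition has_dim ::
  "('f, 'r, 'z) fo_sig_scheme \<Rightarrow> ('f, 'r, 'a::{linordered_field, linorder_topology}) fo_struct \<Rightarrow>
     'v list \<Rightarrow> ('v \<Rightarrow> 'a) set \<Rightarrow> nat \<Rightarrow> bool" where
  "has_dim L M cs X d \<longleftrightarrow>
     (\<exists>ds Y. cell L M 0 cs ds Y \<and> Y \<subseteq> X \<and> sum_list ds = d) \<and>
     (\<forall>ds Y. cell L M 0 cs ds Y \<and> Y \<subseteq> X \<longrightarrow> sum_list ds \<le> d)"


section \<open>Generic derivations\<close>

definition T_derivation ::
  "('f, 'r, 'z) fo_sig_scheme \<Rightarrow> ('f, 'r, 'a::{linordered_field, linorder_topology}) fo_struct \<Rightarrow>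
     ('a \<Rightarrow> 'a) \<Rightarrow> bool" where
  "T_derivation L M \<delta> \<longleftrightarrow>
     (\<forall>n f. \<forall>U :: (nat \<Rightarrow> 'a) set.
       open_in_power {..<n} U \<longrightarrow> definable_fun L M {..<n} U f \<longrightarrow> C_on 1 {..<n} U f \<longrightarrow>
       (\<forall>u\<in>U. \<delta> (f u) = jacobian {..<n} f u (\<lambda>i. \<delta> (u i))))"

definition generic ::
  "('f, 'r, 'z) fo_sig_scheme \<Rightarrow> ('f, 'r, 'a::{linordered_field, linorder_topology}) fo_struct \<Rightarrow>
     ('a \<Rightarrow> 'a) \<Rightarrow> bool" where
  "generic L M \<delta> \<longleftrightarrow>
     (\<forall>n. \<forall>A :: (nat \<Rightarrow> 'a) set.
       definable_set (par_sig L) (par_struct M) {..<Suc n} A \<longrightarrow>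
       has_dim L M [0..<n] ((\<lambda>x. restrict x {..<n}) ` A) n \<longrightarrow>
       (\<exists>a. restrict (\<lambda>i. (\<delta> ^^ i) a) {..<Suc n} \<in> A))"

definition models_Tg ::
  "('f, 'r) of_sig \<Rightarrow> ('f, 'r, nat) fo_form set \<Rightarrow>
     ('f, 'r, 'a::{linordered_field, linorder_topology}) fo_struct \<Rightarrow> ('a \<Rightarrow> 'a) \<Rightarrow> bool" where
  "models_Tg L T M \<delta> \<longleftrightarrow> standard_model L T M \<and> T_derivation L M \<delta> \<and> generic L M \<delta>"


section \<open>Formulas with a derivation, jets and source formulas\<close>

datatype 'g dsym = Base 'g | Delta

definition delta_sig :: "('g, 'r) fo_sig \<Rightarrow> ('g dsym, 'r) fo_sig" where
  "delta_sig L = \<lparr>farity = case_dsym (farity L) 1, rarity = rarity L\<rparr>"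

definition delta_struct ::
  "('g, 'r, 'a) fo_struct \<Rightarrow> ('a \<Rightarrow> 'a) \<Rightarrow> ('g dsym, 'r, 'a) fo_struct" where
  "delta_struct N \<delta> = \<lparr>dom = dom N, fint = case_dsym (fint N) (\<lambda>as. \<delta> (hd as)), rint = rint N\<rparr>"

definition deriv_term :: "nat \<Rightarrow> 'v \<Rightarrow> ('g dsym, 'v) fo_term" where
  "deriv_term j x = ((\<lambda>t. Fn Delta [t]) ^^ j) (Var x)"

fun delta_on_vars_term :: "('g dsym, 'v) fo_term \<Rightarrow> bool" where
  "delta_on_vars_term (Var x) \<longleftrightarrow> True"
| "delta_on_vars_term (Fn (Base g) ts) \<longleftrightarrow> (\<forall>t\<in>set ts. delta_on_vars_term t)"
| "delta_on_vars_term (Fn Delta ts) \<longleftrightarrow> (\<exists>j x. ts = [deriv_term j x])"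

primrec delta_on_vars :: "('g dsym, 'r, 'v) fo_form \<Rightarrow> bool" where
  "delta_on_vars (Equ s t) \<longleftrightarrow> delta_on_vars_term s \<and> delta_on_vars_term t"
| "delta_on_vars (Rel r ts) \<longleftrightarrow> (\<forall>t\<in>set ts. delta_on_vars_term t)"
| "delta_on_vars (Neg \<phi>) \<longleftrightarrow> delta_on_vars \<phi>"
| "delta_on_vars (Conj \<phi> \<psi>) \<longleftrightarrow> delta_on_vars \<phi> \<and> delta_on_vars \<psi>"
| "delta_on_vars (Disj \<phi> \<psi>) \<longleftrightarrow> delta_on_vars \<phi> \<and> delta_on_vars \<psi>"
| "delta_on_vars (Forall x \<phi>) \<longleftrightarrow> delta_on_vars \<phi>"
| "delta_on_vars (Exists x \<phi>) \<longleftrightarrow> delta_on_vars \<phi>"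

text \<open>
  Replacement of \<open>\<delta>\<^sup>j x\<^sub>i\<close> by the variable \<open>(i, j)\<close>, meant for quantifier-free formulas in which
  \<open>\<delta>\<close> is applied to variables and their derivatives only.
\<close>

fun jet_term :: "('g dsym, nat) fo_term \<Rightarrow> ('g, nat \<times> nat) fo_term" where
  "jet_term (Var i) = Var (i, 0)"
| "jet_term (Fn (Base g) ts) = Fn g (map jet_term ts)"
| "jet_term (Fn Delta ts) = (case map jet_term ts of [Var (i, j)] \<Rightarrow> Var (i, Suc j) | _ \<Rightarrow> undefined)"

primrec jet_form :: "('g dsym, 'r, nat) fo_form \<Rightarrow> ('g, 'r, nat \<times> nat) fo_form" where
  "jet_form (Equ s t) = Equ (jet_term s) (jet_term t)"
| "jet_form (Rel r ts) = Rel r (map jet_term ts)"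
| "jet_form (Neg \<phi>) = Neg (jet_form \<phi>)"
| "jet_form (Conj \<phi> \<psi>) = Conj (jet_form \<phi>) (jet_form \<psi>)"
| "jet_form (Disj \<phi> \<psi>) = Disj (jet_form \<phi>) (jet_form \<psi>)"
| "jet_form (Forall i \<phi>) = undefined"
| "jet_form (Exists i \<phi>) = undefined"

text \<open>
  Blocks are numbered \<open>0, \<dots>, k - 1\<close>.  An element of \<open>\<nat>\<^sup>k\<close> is a function \<open>nat \<Rightarrow> nat\<close> that vanishes
  from \<open>k\<close> on; this holds for \<open>ord_of \<phi>\<close> if \<open>\<phi>\<close> has its variables among \<open>x\<^sub>0, \<dots>, x\<^sub>k\<^sub>-\<^sub>1\<close>.
\<close>

definition ord_of :: "('g dsym, 'r, nat) fo_form \<Rightarrow> nat \<Rightarrow> nat" where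
  "ord_of \<phi> i = Max (insert 0 {j. (i, j) \<in> free_vars (jet_form \<phi>)})"

definition rlex_less :: "nat \<Rightarrow> (nat \<Rightarrow> nat) \<Rightarrow> (nat \<Rightarrow> nat) \<Rightarrow> bool" where
  "rlex_less k m n \<longleftrightarrow> (\<exists>i<k. m i < n i \<and> (\<forall>h. i < h \<and> h < k \<longrightarrow> m h = n h))"

definition coords :: "nat \<Rightarrow> (nat \<Rightarrow> nat) \<Rightarrow> (nat \<times> nat) set" where
  "coords k n = {(i, j). i < k \<and> j \<le> n i}"

definition coord_list :: "nat \<Rightarrow> (nat \<Rightarrow> nat) \<Rightarrow> (nat \<times> nat) list" where
  "coord_list k n = concat (map (\<lambda>i. map (Pair i) [0..<Suc (n i)]) [0..<k])"

definition jet_space :: "nat \<Rightarrow> (nat \<Rightarrow> nat) \<Rightarrow> (nat \<times> nat \<Rightarrow> 'a) set" where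
  "jet_space k n = cart_power (coords k n)"

definition Jet :: "('a \<Rightarrow> 'a) \<Rightarrow> nat \<Rightarrow> (nat \<Rightarrow> nat) \<Rightarrow> (nat \<Rightarrow> 'a) \<Rightarrow> nat \<times> nat \<Rightarrow> 'a" where
  "Jet \<delta> k n a = restrict (\<lambda>(i, j). (\<delta> ^^ j) (a i)) (coords k n)"

definition Pi_proj :: "nat \<Rightarrow> (nat \<Rightarrow> nat) \<Rightarrow> (nat \<times> nat \<Rightarrow> 'a) \<Rightarrow> nat \<times> nat \<Rightarrow> 'a" where
  "Pi_proj k m x = restrict x (coords k m)"

definition defined_set ::
  "('f, 'r, 'a) fo_struct \<Rightarrow> ('a \<Rightarrow> 'a) \<Rightarrow> nat \<Rightarrow> (('f + 'a) dsym, 'r, nat) fo_form \<Rightarrow>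
     (nat \<Rightarrow> 'a) set" where
  "defined_set M \<delta> k \<phi> = {a \<in> cart_power {..<k}. sat (delta_struct (par_struct M) \<delta>) a \<phi>}"

definition jet_set ::
  "('f, 'r, 'a) fo_struct \<Rightarrow> nat \<Rightarrow> (('f + 'a) dsym, 'r, nat) fo_form \<Rightarrow>
     (nat \<times> nat \<Rightarrow> 'a) set" where
  "jet_set M k \<phi> = {x \<in> jet_space k (ord_of \<phi>). sat (par_struct M) x (jet_form \<phi>)}"

definition source_formula ::
  "('f, 'r) of_sig \<Rightarrow> ('f, 'r, 'a::{linordered_field, linorder_topology}) fo_struct \<Rightarrow>
     ('a \<Rightarrow> 'a) \<Rightarrow> nat \<Rightarrow> (nat \<Rightarrow> 'a) set \<Rightarrow> (('f + 'a) dsym, 'r, nat) fo_form \<Rightarrow> bool" where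
  "source_formula L M \<delta> k C \<phi> \<longleftrightarrow>
     wf_form (delta_sig (par_sig L)) \<phi> \<and> qfree \<phi> \<and> delta_on_vars \<phi> \<and> free_vars \<phi> \<subseteq> {..<k} \<and>
     defined_set M \<delta> k \<phi> = C \<and>
     (\<exists>ds. cell L M 0 (coord_list k (ord_of \<phi>)) ds (jet_set M k \<phi>)) \<and>
     jet_set M k \<phi> \<subseteq> closure (Jet \<delta> k (ord_of \<phi>) ` C)"

definition delta_cell ::
  "('f, 'r) of_sig \<Rightarrow> ('f, 'r, 'a::{linordered_field, linorder_topology}) fo_struct \<Rightarrow>
     ('a \<Rightarrow> 'a) \<Rightarrow> nat \<Rightarrow> (nat \<Rightarrow> 'a) set \<Rightarrow> bool" where
  "delta_cell L M \<delta> k C \<longleftrightarrow> (\<exists>\<phi>. source_formula L M \<delta> k C \<phi>)"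

definition minimal_source_formula ::
  "('f, 'r) of_sig \<Rightarrow> ('f, 'r, 'a::{linordered_field, linorder_topology}) fo_struct \<Rightarrow>
     ('a \<Rightarrow> 'a) \<Rightarrow> nat \<Rightarrow> (nat \<Rightarrow> 'a) set \<Rightarrow> (('f + 'a) dsym, 'r, nat) fo_form \<Rightarrow> bool" where
  "minimal_source_formula L M \<delta> k C \<phi> \<longleftrightarrow> source_formula L M \<delta> k C \<phi> \<and>
     \<not> (\<exists>\<psi>. source_formula L M \<delta> k C \<psi> \<and> rlex_less k (ord_of \<psi>) (ord_of \<phi>))"


section \<open>Layouts\<close>

definition rho_coords :: "nat \<Rightarrow> (nat \<Rightarrow> nat) \<Rightarrow> nat \<Rightarrow> nat \<Rightarrow> (nat \<times> nat) set" where
  "rho_coords k n i j = {(h, l) \<in> coords k n. h < i \<or> h = i \<and> l < j}"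

definition rho ::
  "nat \<Rightarrow> (nat \<Rightarrow> nat) \<Rightarrow> nat \<Rightarrow> nat \<Rightarrow> (nat \<times> nat \<Rightarrow> 'a) \<Rightarrow> nat \<times> nat \<Rightarrow> 'a" where
  "rho k n i j x = restrict x (rho_coords k n i j)"

type_synonym 'a layout = "nat \<Rightarrow> nat \<Rightarrow> (nat \<times> nat \<Rightarrow> 'a, 'a) layer"

text \<open>
  HOL functions are total, so a layout is unique only up to the values of its functions off
  their domains and up to the entries outside the index range.  Hence being the layout of \<open>D\<close>
  is a relation.
\<close>

definition is_layout ::
  "nat \<Rightarrow> (nat \<Rightarrow> nat) \<Rightarrow> (nat \<times> nat \<Rightarrow> 'a::linorder) set \<Rightarrow> 'a layout \<Rightarrow> bool" where
  "is_layout k n D \<Lambda> \<longleftrightarrow> (\<forall>i<k. \<forall>j\<le>n i.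
     valid_layer (rho k n i j ` D) (\<Lambda> i j) \<and>
     rho k n i (Suc j) ` D = over (rho k n i j ` D) (i, j) (\<Lambda> i j))"

definition prepared :: "nat \<Rightarrow> (nat \<Rightarrow> nat) \<Rightarrow> 'a layout \<Rightarrow> bool" where
  "prepared k n \<Lambda> \<longleftrightarrow> (\<forall>i<k. \<exists>n'\<le>Suc (n i). \<forall>j\<le>n i. is_graph (\<Lambda> i j) \<longleftrightarrow> n' \<le> j)"

definition minimal_layout ::
  "('f, 'r) of_sig \<Rightarrow> ('f, 'r, 'a::{linordered_field, linorder_topology}) fo_struct \<Rightarrow>
     ('a \<Rightarrow> 'a) \<Rightarrow> nat \<Rightarrow> (nat \<Rightarrow> 'a) set \<Rightarrow> (('f + 'a) dsym, 'r, nat) fo_form \<Rightarrow>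
     'a layout \<Rightarrow> bool" where
  "minimal_layout L M \<delta> k C \<phi> \<Lambda> \<longleftrightarrow>
     minimal_source_formula L M \<delta> k C \<phi> \<and> is_layout k (ord_of \<phi>) (jet_set M k \<phi>) \<Lambda>"

definition source_layout ::
  "('f, 'r) of_sig \<Rightarrow> ('f, 'r, 'a::{linordered_field, linorder_topology}) fo_struct \<Rightarrow>
     ('a \<Rightarrow> 'a) \<Rightarrow> nat \<Rightarrow> (nat \<Rightarrow> 'a) set \<Rightarrow> (('f + 'a) dsym, 'r, nat) fo_form \<Rightarrow>
     'a layout \<Rightarrow> bool" where
  "source_layout L M \<delta> k C \<phi> \<Lambda> \<longleftrightarrow>
     minimal_layout L M \<delta> k C \<phi> \<Lambda> \<and> prepared k (ord_of \<phi>) \<Lambda>"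


section \<open>The operator S and configurations\<close>

text \<open>The function \<open>f\<^bsup>[\<delta>]\<^esup>\<close> of a \<open>C\<^sup>1\<close>-function \<open>f\<close> on an open set \<open>U\<close> of \<open>M\<^sup>I\<close>.\<close>

definition delta_part ::
  "('f, 'r, 'z) fo_sig_scheme \<Rightarrow> ('f, 'r, 'a::{linordered_field, linorder_topology}) fo_struct \<Rightarrow>
     ('a \<Rightarrow> 'a) \<Rightarrow> 'v set \<Rightarrow> ('v \<Rightarrow> 'a) set \<Rightarrow> (('v \<Rightarrow> 'a) \<Rightarrow> 'a) \<Rightarrow> ('v \<Rightarrow> 'a) \<Rightarrow> 'a" where
  "delta_part L M \<delta> I U f = (THE g. g \<in> extensional U \<and>
     definable_fun (par_sig L) (par_struct M) I U g \<and> continuous_on U g \<and>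
     (\<forall>u\<in>U. \<delta> (f u) = g u + jacobian I f u (\<lambda>c. \<delta> (u c))))"

definition S_open ::
  "('f, 'r, 'z) fo_sig_scheme \<Rightarrow> ('f, 'r, 'a::{linordered_field, linorder_topology}) fo_struct \<Rightarrow>
     ('a \<Rightarrow> 'a) \<Rightarrow> (nat \<times> nat) set \<Rightarrow> (nat \<times> nat \<Rightarrow> 'a) set \<Rightarrow> ((nat \<times> nat \<Rightarrow> 'a) \<Rightarrow> 'a) \<Rightarrow>
     (nat \<times> nat \<Rightarrow> 'a) \<Rightarrow> 'a" where
  "S_open L M \<delta> I U f x =
     delta_part L M \<delta> I U f (restrict x I) + jacobian I f (restrict x I) (\<lambda>(h, r). x (h, Suc r))"

text \<open>
  For \<open>f\<close> on a cell \<open>B\<close> that need not be open, \<open>S f\<close> is the common value of \<open>S F\<close> for the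
  definable \<open>C\<^sup>1\<close>-extensions \<open>F\<close> of \<open>f\<close> to open neighbourhoods of \<open>B\<close>.  On the relevant cell at
  the next jet level the value does not depend on \<open>F\<close>; elsewhere \<open>S_cell\<close> may be unspecified.
\<close>

definition S_cell ::
  "('f, 'r, 'z) fo_sig_scheme \<Rightarrow> ('f, 'r, 'a::{linordered_field, linorder_topology}) fo_struct \<Rightarrow>
     ('a \<Rightarrow> 'a) \<Rightarrow> (nat \<times> nat) set \<Rightarrow> (nat \<times> nat \<Rightarrow> 'a) set \<Rightarrow> ((nat \<times> nat \<Rightarrow> 'a) \<Rightarrow> 'a) \<Rightarrow>
     (nat \<times> nat \<Rightarrow> 'a) \<Rightarrow> 'a" where
  "S_cell L M \<delta> I B f x =
     (THE w. \<exists>U F. Cp_extension L M 1 I B f U F \<and> w = S_open L M \<delta> I U F x)"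

definition add_ord :: "nat \<Rightarrow> (nat \<Rightarrow> nat) \<Rightarrow> nat \<Rightarrow> nat \<Rightarrow> nat" where
  "add_ord k n r i = (if i < k then n i + r else 0)"

definition layout_cell ::
  "nat \<Rightarrow> (nat \<Rightarrow> nat) \<Rightarrow> 'a::linorder layout \<Rightarrow> (nat \<times> nat \<Rightarrow> 'a) set" where
  "layout_cell k n \<Lambda> =
     {x \<in> jet_space k n. \<forall>i<k. \<forall>j\<le>n i. in_layer (\<Lambda> i j) (rho k n i j x) (x (i, j))}"

fun pullback :: "('q \<Rightarrow> 'p) \<Rightarrow> ('p, 'a) layer \<Rightarrow> ('q, 'a) layer" where
  "pullback \<pi> (Graph f) = Graph (f \<circ> \<pi>)"
| "pullback \<pi> (Band f g) = Band (f \<circ> \<pi>) (g \<circ> \<pi>)"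

text \<open>
  The layers of order at most \<open>n + r\<close> are pulled back along the projection of the larger jet
  space, since block \<open>i\<close> is now preceded by blocks with one more coordinate.
\<close>

primrec extended_layout ::
  "('f, 'r, 'z) fo_sig_scheme \<Rightarrow> ('f, 'r, 'a::{linordered_field, linorder_topology}) fo_struct \<Rightarrow>
     ('a \<Rightarrow> 'a) \<Rightarrow> nat \<Rightarrow> (nat \<Rightarrow> nat) \<Rightarrow> 'a layout \<Rightarrow> nat \<Rightarrow> 'a layout" where
  "extended_layout L M \<delta> k n \<Lambda> 0 = \<Lambda>"
| "extended_layout L M \<delta> k n \<Lambda> (Suc r) =
     (let N = add_ord k n r; \<Lambda>r = extended_layout L M \<delta> k n \<Lambda> r; D = layout_cell k N \<Lambda>r in
      (\<lambda>i j. if j \<le> N i then pullback (rho k N i j) (\<Lambda>r i j)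
            else case \<Lambda>r i (N i) of
                Graph f \<Rightarrow> Graph (S_cell L M \<delta> (rho_coords k N i (N i)) (rho k N i (N i) ` D) f)
              | Band _ _ \<Rightarrow> Band (\<lambda>_. Minf) (\<lambda>_. Pinf)))"

definition lower_configuration ::
  "nat \<Rightarrow> (nat \<times> nat \<Rightarrow> 'a) set \<Rightarrow> (nat \<Rightarrow> nat) \<Rightarrow> (nat \<times> nat \<Rightarrow> 'a) set" where
  "lower_configuration k D m = Pi_proj k m ` D"

definition extended_configuration ::
  "('f, 'r, 'z) fo_sig_scheme \<Rightarrow> ('f, 'r, 'a::{linordered_field, linorder_topology}) fo_struct \<Rightarrow>
     ('a \<Rightarrow> 'a) \<Rightarrow> nat \<Rightarrow> (nat \<Rightarrow> nat) \<Rightarrow> 'a layout \<Rightarrow> nat \<Rightarrow> (nat \<times> nat \<Rightarrow> 'a) set" where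
  "extended_configuration L M \<delta> k n \<Lambda> r =
     layout_cell k (add_ord k n r) (extended_layout L M \<delta> k n \<Lambda> r)"

text \<open>
  The family of lower and extended configurations, as the set of its pairs of an order and a
  cell.  Extended configurations go up to level \<open>p\<close> for a source cell of class \<open>C\<^sup>p\<close>.
\<close>

definition complete_configuration ::
  "('f, 'r, 'z) fo_sig_scheme \<Rightarrow> ('f, 'r, 'a::{linordered_field, linorder_topology}) fo_struct \<Rightarrow>
     ('a \<Rightarrow> 'a) \<Rightarrow> nat \<Rightarrow> nat \<Rightarrow> (nat \<Rightarrow> nat) \<Rightarrow> (nat \<times> nat \<Rightarrow> 'a) set \<Rightarrow> 'a layout \<Rightarrow>
     ((nat \<Rightarrow> nat) \<times> (nat \<times> nat \<Rightarrow> 'a) set) set" where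
  "complete_configuration L M \<delta> p k n D \<Lambda> =
     {(m, lower_configuration k D m) | m. m \<le> n} \<union>
     {(add_ord k n r, extended_configuration L M \<delta> k n \<Lambda> r) | r. r \<le> p}"

end

theory Submission
  imports Defs
begin

text \<open>
  Since \<open>Jet(C)\<close> lies in every source cell and is dense in it, source cells of the same order have
  the same closure.  A cell is determined by its closure: the projection of the closure has the
  closure of the base as its closure, and over a fixed base the continuous functions that bound the
  cell can be read off from its relative closure.  Minimal source formulas have the same order
  because \<open>rlex_less\<close> is total.  Finally \<open>S f\<close> depends only on the values of \<open>f\<close> on the base, so a
  layout of the common cell determines the extended cells.
\<close>

section \<open>Cells with the same closure\<close>

lemma extended_between:
  fixes l u :: "'a::unbounded_dense_linorder extended"
  assumes "l < u"
  obtains b where "l < Fin b" "Fin b < u"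
proof -
  have "\<exists>b. l < Fin b \<and> Fin b < u"
    using assms by (cases l; cases u) (auto intro: dense gt_ex lt_ex)
  with that show thesis by blast
qed

text \<open>Weak inequalities pass to the limit along the filter at \<open>z\<close> within
  \<open>T\<close>, which is nontrivial unless \<open>z\<close> already lies in \<open>T\<close>.
  Continuity is relative to \<open>S\<close>, because the bounds of a cell are continuous only over
  its base.\<close>

lemma le_on_closure:
  fixes f g :: "'b::topological_space \<Rightarrow> 'a::linorder_topology"
  assumes "continuous_on S f" "continuous_on S g" "T \<subseteq> S" "z \<in> S" "z \<in> closure T"
    and "\<And>t. t \<in> T \<Longrightarrow> f t \<le> g t"
  shows "f z \<le> g z"
proof (cases "z \<in> T")
  case True
  with assms(6) show ?thesis .
next
  case False
  with assms(5) have "at z within T \<noteq> bot"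
    by (auto simp: closure_def trivial_limit_within)
  moreover have "(f \<longlongrightarrow> f z) (at z within T)" "(g \<longlongrightarrow> g z) (at z within T)"
    using assms(1-4) by (auto simp: continuous_on_def intro: tendsto_within_subset)
  moreover have "eventually (\<lambda>t. f t \<le> g t) (at z within T)"
    using assms(6) by (simp add: eventually_at_filter)
  ultimately show ?thesis by (metis tendsto_le)
qed

text \<open>For continuous bounds this contains the fibre, over a point of the base, of the closure
  of the layer.\<close>

fun in_closed_layer :: "('p, 'a::linorder) layer \<Rightarrow> 'p \<Rightarrow> 'a \<Rightarrow> bool" where
  "in_closed_layer (Graph f) x b \<longleftrightarrow> b = f x"
| "in_closed_layer (Band f g) x b \<longleftrightarrow> f x \<le> Fin b \<and> Fin b \<le> g x"

lemma in_layer_exists: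
  fixes \<Lambda> :: "('p, 'a::unbounded_dense_linorder) layer"
  assumes "valid_layer B \<Lambda>" "x \<in> B"
  obtains b where "in_layer \<Lambda> x b"
  using assms by (cases \<Lambda>) (auto elim: extended_between[of "f x" "g x" for f g])

text \<open>A graph has a single point over each base point, so this tells bands from
  graphs.\<close>

lemma band_two_points:
  fixes f g :: "'p \<Rightarrow> 'a::unbounded_dense_linorder extended"
  assumes "f x < g x"
  obtains a b where "a \<noteq> b" "in_layer (Band f g) x a" "in_layer (Band f g) x b"
proof -
  obtain a where a: "f x < Fin a" "Fin a < g x" using assms by (rule extended_between)
  obtain b where b: "f x < Fin b" "Fin b < Fin a" using a(1) by (rule extended_between)
  show thesis
  proof (rule that)
    show "a \<noteq> b" using b(2) by auto
    show "in_layer (Band f g) x a" using a by simp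
    show "in_layer (Band f g) x b" using b less_trans[OF b(2) a(2)] by simp
  qed
qed

lemma interval_subset_closed_interval:
  fixes l u l' u' :: "'a::unbounded_dense_linorder extended"
  assumes "l < u" "\<And>b. l < Fin b \<Longrightarrow> Fin b < u \<Longrightarrow> l' \<le> Fin b \<and> Fin b \<le> u'"
  shows "l' \<le> l" "u \<le> u'"
proof -
  show "l' \<le> l"
  proof (rule ccontr)
    assume "\<not> l' \<le> l"
    \<comment> \<open>The minimum with \<open>u\<close> keeps the chosen \<open>b\<close> inside the
      open interval while it lies below \<open>l'\<close>.\<close>
    with assms(1) have "l < min l' u" by (simp add: not_le)
    then obtain b where "l < Fin b" "Fin b < min l' u" by (rule extended_between)
    with assms(2)[of b] show False by auto
  qed
  show "u \<le> u'"
  proof (rule ccontr)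
    assume "\<not> u \<le> u'"
    with assms(1) have "max l u' < u" by (simp add: not_le)
    then obtain b where "max l u' < Fin b" "Fin b < u" by (rule extended_between)
    with assms(2)[of b] show False by auto
  qed
qed

text \<open>Two graphs agree at once, and a graph cannot contain the two points of a band. For two
  bands, each open interval lies in the closed interval of the other, which forces equal end
  points.\<close>

lemma layers_eqI:
  fixes \<Lambda> \<Lambda>' :: "('p, 'a::unbounded_dense_linorder) layer"
  assumes "valid_layer B \<Lambda>" "valid_layer B \<Lambda>'" "x \<in> B"
    and "\<And>b. in_layer \<Lambda> x b \<Longrightarrow> in_closed_layer \<Lambda>' x b"
    and "\<And>b. in_layer \<Lambda>' x b \<Longrightarrow> in_closed_layer \<Lambda> x b"
  shows "in_layer \<Lambda> x b \<longleftrightarrow> in_layer \<Lambda>' x b"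
proof (cases \<Lambda>)
  case (Graph f)
  show ?thesis
  proof (cases \<Lambda>')
    case (Graph f')
    with assms(4) \<open>\<Lambda> = Graph f\<close> show ?thesis by simp
  next
    case (Band f' g')
    with assms(2,3) have "f' x < g' x" by simp
    then obtain a c where "a \<noteq> c" "in_layer \<Lambda>' x a" "in_layer \<Lambda>' x c"
      unfolding Band by (rule band_two_points)
    with assms(5)[of a] assms(5)[of c] Graph show ?thesis by simp
  qed
next
  case (Band f g)
  show ?thesis
  proof (cases \<Lambda>')
    case (Graph f')
    from Band assms(1,3) have "f x < g x" by simp
    then obtain a c where "a \<noteq> c" "in_layer \<Lambda> x a" "in_layer \<Lambda> x c"
      unfolding Band by (rule band_two_points)
    with assms(4)[of a] assms(4)[of c] Graph show ?thesis by simp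
  next
    case (Band f' g')
    have "f x < g x" "f' x < g' x"
      using Band \<open>\<Lambda> = Band f g\<close> assms(1-3) by auto
    with assms(4,5) have "f x = f' x" "g x = g' x"
      unfolding Band \<open>\<Lambda> = Band f g\<close>
      using interval_subset_closed_interval[of "f x" "g x" "f' x" "g' x"]
        interval_subset_closed_interval[of "f' x" "g' x" "f x" "g x"]
      by (auto intro: antisym)
    with Band \<open>\<Lambda> = Band f g\<close> show ?thesis by simp
  qed
qed

section \<open>Closures and projections of cells\<close>

lemma cell_subset_power: "cell L M p cs ds X \<Longrightarrow> X \<subseteq> cart_power (set cs)"
  by (induction rule: cell.induct) (auto simp: over_def PiE_def extensional_def)

lemma cell_nonempty:
  fixes M :: "('f, 'r, 'a::{linordered_field, linorder_topology}) fo_struct"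
  shows "cell L M p cs ds X \<Longrightarrow> X \<noteq> {}"
proof (induction rule: cell.induct)
  case (2 cs ds B c \<Lambda>)
  then obtain x where "x \<in> B" by blast
  with 2 obtain b where "in_layer \<Lambda> x b" by (auto elim: in_layer_exists)
  with \<open>x \<in> B\<close> show ?case unfolding over_def by blast
qed simp

text \<open>Taking \<open>undefined\<close> for \<open>a\<close> encodes the projection that forgets
  the coordinate \<open>c\<close>, since points of a power are undefined off their index
  set.\<close>

lemma continuous_on_fun_upd_const: "continuous_on S (\<lambda>z. z(c := a))"
  for S :: "('v \<Rightarrow> 'a::topological_space) set"
proof (rule continuous_on_coordinatewise_then_product)
  fix d
  show "continuous_on S (\<lambda>z. (z(c := a)) d)"
    by (cases "d = c") (auto intro: continuous_on_subset[OF continuous_on_product_coordinates])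
qed

text \<open>Pulled back to the points above \<open>B\<close>, the finite bounds are continuous, and
  their weak inequalities with the last coordinate survive in the closure relative to this set. The
  point \<open>x\<close> is taken in \<open>B\<close> because a bound need not extend continuously
  to the frontier of \<open>B\<close>.\<close>

lemma over_closure_in_closed_layer:
  fixes M :: "('f, 'r, 'a::{linordered_field, linorder_topology}) fo_struct"
  assumes B: "B \<subseteq> cart_power I" and c: "c \<notin> I" and \<Lambda>: "layer_of_class L M p I B \<Lambda>"
    and x: "x \<in> B" and z: "x(c := b) \<in> closure (over B c \<Lambda>)"
  shows "in_closed_layer \<Lambda> x b"
proof -
  have upd: "y(c := undefined) = y" if "y \<in> B" for y
  proof -
    have "y c = undefined" using that B c by (auto simp: PiE_def extensional_def)
    then show ?thesis by (rule fun_upd_idem)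
  qed
  define \<pi> :: "('b \<Rightarrow> 'a) \<Rightarrow> 'b \<Rightarrow> 'a" where "\<pi> = (\<lambda>z. z(c := undefined))"
  define S where "S = {z. \<pi> z \<in> B}"
  have \<pi>: "\<pi> (y(c := a)) = y" if "y \<in> B" for y a
    using upd[OF that] by (simp add: \<pi>_def)
  have sub: "over B c \<Lambda> \<subseteq> S" and xS: "x(c := b) \<in> S"
    using x \<pi> by (auto simp: S_def over_def)
  have coord: "continuous_on S (\<lambda>z. z c)"
    by (rule continuous_on_subset[OF continuous_on_product_coordinates]) simp
  have cont: "continuous_on S (\<lambda>z. h (\<pi> z))" if "class_C L M p I B h" for h
  proof (rule continuous_on_compose2[where g = h and t = B])
    show "continuous_on B h" using that by (simp add: class_C_def)
    show "continuous_on S \<pi>" unfolding \<pi>_def by (rule continuous_on_fun_upd_const)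
    show "\<pi> ` S \<subseteq> B" by (auto simp: S_def)
  qed
  have ge: "h x \<le> b" if h: "class_C L M p I B h"
    and le: "\<And>y a. y \<in> B \<Longrightarrow> in_layer \<Lambda> y a \<Longrightarrow> h y \<le> a" for h
  proof -
    have "h (\<pi> t) \<le> t c" if "t \<in> over B c \<Lambda>" for t
      using that le \<pi> by (auto simp: over_def)
    from le_on_closure[OF cont[OF h] coord sub xS z this] \<pi>[OF x] show ?thesis
      by (simp del: fun_upd_apply add: fun_upd_same)
  qed
  have le: "b \<le> h x" if h: "class_C L M p I B h"
    and ge: "\<And>y a. y \<in> B \<Longrightarrow> in_layer \<Lambda> y a \<Longrightarrow> a \<le> h y" for h
  proof -
    have "t c \<le> h (\<pi> t)" if "t \<in> over B c \<Lambda>" for t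
      using that ge \<pi> by (auto simp: over_def)
    from le_on_closure[OF coord cont[OF h] sub xS z this] \<pi>[OF x] show ?thesis
      by (simp del: fun_upd_apply add: fun_upd_same)
  qed
  show ?thesis
  proof (cases \<Lambda>)
    case (Graph f)
    with \<Lambda> ge[of f] le[of f] show ?thesis by auto
  next
    case (Band f g)
    \<comment> \<open>A point of the layer rules out the lower bound \<open>Pinf\<close> and the
      upper bound \<open>Minf\<close>. The other infinite bounds impose no condition.\<close>
    have ne: "B \<noteq> {}" "over B c \<Lambda> \<noteq> {}" using x z by auto
    then obtain y a where y: "y \<in> B" "f y < Fin a" "Fin a < g y"
      using Band by (auto simp: over_def)
    have "f x \<le> Fin b"
    proof -
      consider "\<forall>x\<in>B. f x = Minf" | "\<forall>x\<in>B. f x = Pinf"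
        | h where "class_C L M p I B h" "\<forall>x\<in>B. f x = Fin (h x)"
        using \<Lambda> Band by (auto simp: bound_of_class_def)
      then show ?thesis
      proof cases
        case 3
        with ge[of h] Band x show ?thesis by (auto intro: less_imp_le)
      qed (use x y in auto)
    qed
    moreover have "Fin b \<le> g x"
    proof -
      consider "\<forall>x\<in>B. g x = Minf" | "\<forall>x\<in>B. g x = Pinf"
        | h where "class_C L M p I B h" "\<forall>x\<in>B. g x = Fin (h x)"
        using \<Lambda> Band by (auto simp: bound_of_class_def)
      then show ?thesis
      proof cases
        case 3
        with le[of h] Band x show ?thesis by (auto intro: less_imp_le)
      qed (use x y in auto)
    qed
    ultimately show ?thesis using Band by simp
  qed
qed

text \<open>Each point of \<open>B\<close> has a nonempty fibre, and the continuous projection that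
  forgets \<open>c\<close> carries closure points of the layer over \<open>B'\<close> to closure
  points of \<open>B'\<close>.\<close>

lemma over_base_subset_closure:
  fixes \<Lambda> :: "('v \<Rightarrow> 'a::{unbounded_dense_linorder, linorder_topology}, 'a) layer"
  assumes "B \<subseteq> cart_power I" "B' \<subseteq> cart_power I" "c \<notin> I" "valid_layer B \<Lambda>"
    and "over B c \<Lambda> \<subseteq> closure (over B' c \<Lambda>')"
  shows "B \<subseteq> closure B'"
proof
  fix x assume x: "x \<in> B"
  with assms(4) obtain b where "in_layer \<Lambda> x b" by (rule in_layer_exists)
  with x assms(5) have z: "x(c := b) \<in> closure (over B' c \<Lambda>')"
    by (auto simp: over_def)
  have "(\<lambda>z. z(c := undefined)) ` over B' c \<Lambda>' \<subseteq> B'"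
    using assms(2,3) by (auto simp: over_def PiE_def extensional_def fun_upd_idem)
  with z have "(x(c := b))(c := undefined) \<in> closure B'"
    using image_closure_subset[OF continuous_on_fun_upd_const closed_closure, of c undefined _ B'] 
      closure_subset by blast
  with x assms(1,3) show "x \<in> closure B'"
    by (auto simp: PiE_def extensional_def fun_upd_idem)
qed

text \<open>Induction along the coordinate list. Projecting shows that the bases have the same
  closure, so they are equal by induction; over the common base, each layer then lies fibrewise in
  the closed layer of the other.\<close>

lemma cell_eq_if_closure_eq:
  fixes M :: "('f, 'r, 'a::{linordered_field, linorder_topology}) fo_struct"
  assumes "cell L M p cs ds X" "cell L M q cs ds' Y" "X \<subseteq> closure Y" "Y \<subseteq> closure X"
  shows "X = Y"
  using assms
proof (induction arbitrary: ds' Y rule: cell.induct)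
  case 1
  from 1(1) show ?case by cases auto
next
  case (2 cs ds B c \<Lambda>)
  \<comment> \<open>Both cells are built along the same list, so inversion splits \<open>Y\<close>
    along the same last coordinate \<open>c\<close>.\<close>
  from 2(6) obtain ds'' B' \<Lambda>' where Y: "Y = over B' c \<Lambda>'" "cell L M q cs ds'' B'"
    "valid_layer B' \<Lambda>'" "layer_of_class L M q (set cs) B' \<Lambda>'"
    by cases auto
  note B = cell_subset_power[OF 2(1)] and B' = cell_subset_power[OF Y(2)]
  have "B \<subseteq> closure B'" "B' \<subseteq> closure B"
    using over_base_subset_closure[OF B B' 2(2,3)] over_base_subset_closure[OF B' B 2(2) Y(3)]
      2(7,8) Y(1) by auto
  with 2(5)[OF Y(2)] have BB: "B' = B" by simp
  have "in_layer \<Lambda> x b \<longleftrightarrow> in_layer \<Lambda>' x b" if "x \<in> B" for x b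
  proof (rule layers_eqI[of B])
    show "in_closed_layer \<Lambda>' x b" if "in_layer \<Lambda> x b" for b
      using that \<open>x \<in> B\<close> 2(7) Y BB
      by (intro over_closure_in_closed_layer[OF B 2(2), of L M q]) (auto simp: over_def)
    show "in_closed_layer \<Lambda> x b" if "in_layer \<Lambda>' x b" for b
      using that \<open>x \<in> B\<close> 2(4,8) Y BB
      by (intro over_closure_in_closed_layer[OF B 2(2), of L M p]) (auto simp: over_def)
  qed (use that 2(3) Y(3) BB in auto)
  then show ?case using Y(1) BB by (auto simp: over_def)
qed

section \<open>Jets and source formulas\<close>

lemma jet_term_deriv_term [simp]: "jet_term (deriv_term j x) = Var (x, j)"
  by (induction j) (auto simp: deriv_term_def)

lemma term_vars_deriv_term [simp]: "term_vars (deriv_term j x) = {x}"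
  by (induction j) (auto simp: deriv_term_def)

lemma val_deriv_term [simp]: "val (delta_struct N \<delta>) a (deriv_term j x) = (\<delta> ^^ j) (a x)"
  by (induction j) (auto simp: deriv_term_def delta_struct_def)

lemma fint_delta_struct: "fint (delta_struct N \<delta>) (Base g) = fint N g"
  and fint_Delta: "fint (delta_struct N \<delta>) Delta [b] = \<delta> b"
  and rint_delta_struct: "rint (delta_struct N \<delta>) = rint N"
  by (simp_all add: delta_struct_def)

lemma jet_term_vars: "delta_on_vars_term t \<Longrightarrow> fst ` term_vars (jet_term t) \<subseteq> term_vars t"
  by (induction t rule: delta_on_vars_term.induct) fastforce+

lemma jet_form_vars:
  "qfree \<phi> \<Longrightarrow> delta_on_vars \<phi> \<Longrightarrow> fst ` free_vars (jet_form \<phi>) \<subseteq> free_vars \<phi>"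
proof (induction \<phi>)
  case (Equ s t)
  then show ?case using jet_term_vars[of s] jet_term_vars[of t] by auto
next
  case (Rel r ts)
  then show ?case using jet_term_vars by fastforce
qed auto

text \<open>Agreement with the derivatives is asked only at variables that occur, because a jet
  stores only the derivatives up to the order.\<close>

lemma val_jet_term:
  assumes "delta_on_vars_term t" "\<And>i j. (i, j) \<in> term_vars (jet_term t) \<Longrightarrow> x (i, j) = (\<delta> ^^ j) (a i)"
  shows "val N x (jet_term t) = val (delta_struct N \<delta>) a t"
  using assms
proof (induction t rule: delta_on_vars_term.induct)
  case (2 g ts)
  have "val N x (jet_term t) = val (delta_struct N \<delta>) a t" if "t \<in> set ts" for t
    using that 2(2,3) by (intro 2(1)) auto
  then have "map (val N x \<circ> jet_term) ts = map (val (delta_struct N \<delta>) a) ts"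
    by simp
  then have "fint N g (map (val N x \<circ> jet_term) ts) =
      fint N g (map (val (delta_struct N \<delta>) a) ts)" by (rule arg_cong)
  then show ?case by (simp add: fint_delta_struct del: map_eq_conv)
next
  case (3 ts)
  then obtain j y where "ts = [deriv_term j y]" by auto
  \<comment> \<open>One more derivation on \<open>deriv_term j y\<close> gives the jet coordinate of
    order \<open>Suc j\<close>.\<close>
  with 3(2)[of y "Suc j"] show ?case by (simp add: fint_Delta)
qed simp

lemma sat_jet_form:
  assumes "qfree \<phi>" "delta_on_vars \<phi>"
    and "\<And>i j. (i, j) \<in> free_vars (jet_form \<phi>) \<Longrightarrow> x (i, j) = (\<delta> ^^ j) (a i)"
  shows "sat N x (jet_form \<phi>) \<longleftrightarrow> sat (delta_struct N \<delta>) a \<phi>"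
  using assms
proof (induction \<phi>)
  case (Equ s t)
  then show ?case using val_jet_term[of s x \<delta> a N] val_jet_term[of t x \<delta> a N] by auto
next
  case (Rel r ts)
  have "val N x (jet_term t) = val (delta_struct N \<delta>) a t" if "t \<in> set ts" for t
    using that Rel(2,3) by (intro val_jet_term) auto
  then have "map (val N x \<circ> jet_term) ts = map (val (delta_struct N \<delta>) a) ts"
    by simp
  then have "rint N r (map (val N x \<circ> jet_term) ts) =
      rint N r (map (val (delta_struct N \<delta>) a) ts)" by (rule arg_cong)
  then show ?case by (simp add: rint_delta_struct del: map_eq_conv)
qed auto

section \<open>Orders and source cells\<close>

lemma finite_term_vars: "finite (term_vars t)"
  by (induction t) auto

lemma finite_free_vars: "finite (free_vars \<phi>)"
  by (induction \<phi>) (auto simp: finite_term_vars)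

text \<open>The maximum in \<open>ord_of\<close> is a genuine one because a formula has finitely
  many variables.\<close>

lemma le_ord_of: "(i, j) \<in> free_vars (jet_form \<phi>) \<Longrightarrow> j \<le> ord_of \<phi> i"
proof -
  assume "(i, j) \<in> free_vars (jet_form \<phi>)"
  moreover have "finite {j. (i, j) \<in> free_vars (jet_form \<phi>)}"
    by (rule finite_subset[OF _ finite_imageI[OF finite_free_vars, of snd "jet_form \<phi>"]]) force
  ultimately show ?thesis by (simp add: ord_of_def)
qed

text \<open>Together with the density clause of \<open>source_formula\<close>, this gives the source
  cell and the set of jets of \<open>C\<close> the same closure.\<close>

lemma Jet_in_jet_set:
  assumes "source_formula L M \<delta> k C \<phi>"
  shows "Jet \<delta> k (ord_of \<phi>) ` C \<subseteq> jet_set M k \<phi>"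
proof
  fix x assume "x \<in> Jet \<delta> k (ord_of \<phi>) ` C"
  then obtain a where a: "a \<in> defined_set M \<delta> k \<phi>" and x: "x = Jet \<delta> k (ord_of \<phi>) a"
    using assms by (auto simp: source_formula_def)
  have q: "qfree \<phi>" "delta_on_vars \<phi>" "free_vars \<phi> \<subseteq> {..<k}"
    using assms by (auto simp: source_formula_def)
  have "x (i, j) = (\<delta> ^^ j) (a i)" if "(i, j) \<in> free_vars (jet_form \<phi>)" for i j
  proof -
    have "i < k" using that jet_form_vars[OF q(1,2)] q(3) by force
    with le_ord_of[OF that] show ?thesis by (simp add: x Jet_def coords_def)
  qed
  from sat_jet_form[OF q(1,2) this] a have "sat (par_struct M) x (jet_form \<phi>)"
    by (simp add: defined_set_def)
  then show "x \<in> jet_set M k \<phi>"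
    by (simp add: jet_set_def jet_space_def x Jet_def)
qed

text \<open>Makes orders comparable as total functions, since \<open>rlex_less\<close> inspects only
  the indices below \<open>k\<close>.\<close>

lemma ord_of_eq_0:
  assumes "source_formula L M \<delta> k C \<phi>" "k \<le> i"
  shows "ord_of \<phi> i = 0"
proof -
  have "{j. (i, j) \<in> free_vars (jet_form \<phi>)} = {}"
    using assms jet_form_vars[of \<phi>] by (force simp: source_formula_def)
  then show ?thesis by (simp add: ord_of_def)
qed

text \<open>At the largest index below \<open>k\<close> where \<open>m\<close> and \<open>n\<close>
  differ, one of the two values is smaller, and this decides the order.\<close>

lemma rlex_total:
  assumes "\<not> rlex_less k m n" "\<not> rlex_less k n m" "i < k"
  shows "m i = n i"
proof (rule ccontr)
  assume "m i \<noteq> n i"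
  define h where "h = Max {i. i < k \<and> m i \<noteq> n i}"
  have fin: "finite {i. i < k \<and> m i \<noteq> n i}" by simp
  have "h \<in> {i. i < k \<and> m i \<noteq> n i}"
    unfolding h_def by (rule Max_in[OF fin]) (use \<open>m i \<noteq> n i\<close> \<open>i < k\<close> in blast)
  then have "h < k" "m h \<noteq> n h" by auto
  moreover have "m l = n l" if "h < l" "l < k" for l
  proof (rule ccontr)
    assume "m l \<noteq> n l"
    with that(2) Max_ge[OF fin, of l] have "l \<le> h" by (simp add: h_def)
    with that(1) show False by simp
  qed
  ultimately have "rlex_less k m n \<or> rlex_less k n m"
    unfolding rlex_less_def by (metis nat_neq_iff)
  with assms show False by blast
qed

lemma minimal_source_formulas_ord_of_eq:
  assumes "minimal_source_formula L M \<delta> k C \<phi>" "minimal_source_formula L M \<delta> k C \<psi>"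
  shows "ord_of \<phi> = ord_of \<psi>"
proof
  fix i
  show "ord_of \<phi> i = ord_of \<psi> i"
    using assms rlex_total[of k "ord_of \<phi>" "ord_of \<psi>" i] ord_of_eq_0[of L M \<delta> k C _ i]
    unfolding minimal_source_formula_def by (cases "i < k") force+
qed

text \<open>Equal orders put both source cells into one jet space, where each lies in the closure of
  the same set of jets, hence in the closure of the other.\<close>

lemma source_cells_eq:
  assumes "source_formula L M \<delta> k C \<phi>" "source_formula L M \<delta> k C \<psi>" "ord_of \<phi> = ord_of \<psi>"
  shows "jet_set M k \<phi> = jet_set M k \<psi>"
proof -
  obtain ds ds' where
    "cell L M 0 (coord_list k (ord_of \<phi>)) ds (jet_set M k \<phi>)"
    "cell L M 0 (coord_list k (ord_of \<phi>)) ds' (jet_set M k \<psi>)"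
    using assms by (auto simp: source_formula_def)
  moreover have "jet_set M k \<phi> \<subseteq> closure (jet_set M k \<psi>)"
    using assms closure_mono[OF Jet_in_jet_set[OF assms(2)]] by (auto simp: source_formula_def)
  moreover have "jet_set M k \<psi> \<subseteq> closure (jet_set M k \<phi>)"
    using assms closure_mono[OF Jet_in_jet_set[OF assms(1)]] by (auto simp: source_formula_def)
  ultimately show ?thesis by (rule cell_eq_if_closure_eq)
qed

section \<open>Extended configurations\<close>

lemma rho_coords_Suc: "rho_coords k n (Suc i) 0 = rho_coords k n i (Suc (n i))"
  by (auto simp: rho_coords_def coords_def less_Suc_eq)

lemma rho_coords_k: "rho_coords k n k 0 = coords k n"
  by (auto simp: rho_coords_def coords_def)

lemma rho_Suc:
  "i < k \<Longrightarrow> j \<le> n i \<Longrightarrow> rho k n i (Suc j) x = (rho k n i j x)((i, j) := x (i, j))"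
  by (auto simp: rho_def rho_coords_def coords_def fun_eq_iff restrict_def)

text \<open>Ensures that a point of \<open>over\<close> splits in only one way into a base point and
  a last coordinate.\<close>

lemma fun_upd_undefined_inj:
  assumes "x(c := a) = y(c := b)" "x c = undefined" "y c = undefined"
  shows "x = y" "a = b"
proof -
  show "a = b" using fun_cong[OF assms(1), of c] by simp
  show "x = y" using assms by (metis fun_upd_triv fun_upd_upd)
qed

lemma rho_self: "rho k n i j x (i, j) = undefined"
  by (simp add: rho_def rho_coords_def)

lemma fun_upd_in_over_iff:
  assumes "x c = undefined" "\<And>y. y \<in> B \<Longrightarrow> y c = undefined"
  shows "x(c := b) \<in> over B c \<Lambda> \<longleftrightarrow> x \<in> B \<and> in_layer \<Lambda> x b"
proof
  assume "x(c := b) \<in> over B c \<Lambda>"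
  then obtain y a where y: "x(c := b) = y(c := a)" "y \<in> B" "in_layer \<Lambda> y a"
    unfolding over_def by blast
  from fun_upd_undefined_inj[OF y(1) assms(1) assms(2)[OF y(2)]] y(2,3)
  show "x \<in> B \<and> in_layer \<Lambda> x b" by simp
qed (auto simp: over_def)

lemma rho_in_over_iff:
  assumes "i < k" "j \<le> n i"
  shows "rho k n i (Suc j) x \<in> over (rho k n i j ` D) (i, j) \<Lambda> \<longleftrightarrow>
    rho k n i j x \<in> rho k n i j ` D \<and> in_layer \<Lambda> (rho k n i j x) (x (i, j))"
  unfolding rho_Suc[of i k j n, OF assms]
  by (rule fun_upd_in_over_iff) (auto simp: rho_self)

text \<open>Membership in \<open>D\<close> is decided one coordinate at a time, first along a block
  and then from block to block, until the projection is the identity on the jet space.\<close>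

lemma layout_cell_eq:
  assumes "is_layout k n D \<Lambda>" "D \<subseteq> jet_space k n" "D \<noteq> {}"
  shows "layout_cell k n \<Lambda> = D"
proof -
  let ?in = "\<lambda>x i j. in_layer (\<Lambda> i j) (rho k n i j x) (x (i, j))"
  have layer: "rho k n i (Suc j) x \<in> rho k n i (Suc j) ` D \<longleftrightarrow>
      rho k n i j x \<in> rho k n i j ` D \<and> ?in x i j" if "i < k" "j \<le> n i" for i j x
    using assms(1) that rho_in_over_iff[of i k j n x D "\<Lambda> i j", OF that] by (auto simp: is_layout_def)
  have block: "rho k n i j x \<in> rho k n i j ` D \<longleftrightarrow>
      rho k n i 0 x \<in> rho k n i 0 ` D \<and> (\<forall>l<j. ?in x i l)" if "i < k" "j \<le> Suc (n i)" for i j x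
    using that(2) by (induction j) (auto simp: layer[OF that(1)] less_Suc_eq)
  have all: "rho k n i 0 x \<in> rho k n i 0 ` D \<longleftrightarrow> (\<forall>h<i. \<forall>l\<le>n h. ?in x h l)" if "i \<le> k" for i x
    using that
  proof (induction i)
    case 0
    \<comment> \<open>Before the first block the projection has a single value, so the claim amounts
      to \<open>D\<close> being nonempty.\<close>
    show ?case using assms(3) by (auto simp: rho_def rho_coords_def restrict_def)
  next
    case (Suc i)
    \<comment> \<open>Block \<open>i\<close> has \<open>Suc (n i)\<close> coordinates, and keeping
      all of them is the same as standing at the start of block \<open>Suc i\<close>.\<close>
    have eq: "rho k n (Suc i) 0 = (rho k n i (Suc (n i)) :: (nat \<times> nat \<Rightarrow> 'a) \<Rightarrow> _)"
      by (simp add: rho_def rho_coords_Suc fun_eq_iff)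
    have "rho k n (Suc i) 0 x \<in> rho k n (Suc i) 0 ` D \<longleftrightarrow>
        rho k n i 0 x \<in> rho k n i 0 ` D \<and> (\<forall>l<Suc (n i). ?in x i l)"
      unfolding eq by (rule block) (use Suc.prems in auto)
    also have "\<dots> \<longleftrightarrow> (\<forall>h<i. \<forall>l\<le>n h. ?in x h l) \<and> (\<forall>l\<le>n i. ?in x i l)"
      using Suc by (simp only: less_Suc_eq_le Suc_leD)
    also have "\<dots> \<longleftrightarrow> (\<forall>h<Suc i. \<forall>l\<le>n h. ?in x h l)"
      unfolding less_Suc_eq by blast
    finally show ?case .
  qed
  have rho_id: "rho k n k 0 x = x" if "x \<in> jet_space k n" for x :: "nat \<times> nat \<Rightarrow> 'a"
    using that by (simp add: rho_def rho_coords_k jet_space_def)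
  have "rho k n k 0 ` D = D" using assms(2) rho_id by force
  with all[OF order_refl] rho_id have
    "x \<in> D \<longleftrightarrow> (\<forall>h<k. \<forall>l\<le>n h. ?in x h l)" if "x \<in> jet_space k n" for x
    using that all[OF order_refl, of x] by simp
  with assms(2) show ?thesis unfolding layout_cell_def by blast
qed

section \<open>Comparing two layouts of one cell\<close>

text \<open>The bounds of bands are not compared, since a band of any bounds is extended by the full band.\<close>

fun layer_agree :: "'p set \<Rightarrow> ('p, 'a) layer \<Rightarrow> ('p, 'a) layer \<Rightarrow> bool" where
  "layer_agree B (Graph f) (Graph g) \<longleftrightarrow> (\<forall>x\<in>B. f x = g x)"
| "layer_agree B (Band _ _) (Band _ _) \<longleftrightarrow> True"
| "layer_agree B _ _ \<longleftrightarrow> False"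

lemma layer_agree_refl: "layer_agree B \<Lambda> \<Lambda>"
  by (cases \<Lambda>) auto

text \<open>One point of the base excludes a graph facing a band, because the fibre of the graph has
  one point and that of the band at least two.\<close>

lemma layer_agreeI:
  fixes \<Lambda> \<Lambda>' :: "('p, 'a::unbounded_dense_linorder) layer"
  assumes "B \<noteq> {}" "valid_layer B \<Lambda>" "valid_layer B \<Lambda>'"
    and "\<And>x b. x \<in> B \<Longrightarrow> in_layer \<Lambda> x b \<longleftrightarrow> in_layer \<Lambda>' x b"
  shows "layer_agree B \<Lambda> \<Lambda>'"
proof -
  obtain x where x: "x \<in> B" using assms(1) by blast
  show ?thesis
  proof (cases \<Lambda>; cases \<Lambda>')
    fix f f' g'
    assume "\<Lambda> = Graph f" "\<Lambda>' = Band f' g'"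
    moreover from this assms(3) x obtain a b
      where "a \<noteq> b" "in_layer \<Lambda>' x a" "in_layer \<Lambda>' x b"
      by (metis band_two_points valid_layer.simps(2))
    ultimately show ?thesis using assms(4)[OF x, of a] assms(4)[OF x, of b] by simp
  next
    fix f g f'
    assume "\<Lambda> = Band f g" "\<Lambda>' = Graph f'"
    moreover from this assms(2) x obtain a b
      where "a \<noteq> b" "in_layer \<Lambda> x a" "in_layer \<Lambda> x b"
      by (metis band_two_points valid_layer.simps(2))
    ultimately show ?thesis using assms(4)[OF x, of a] assms(4)[OF x, of b] by simp
  qed (use assms(4) in auto)
qed

text \<open>Both layers cut out the same projection of \<open>D\<close> over the same base, so their
  fibres coincide.\<close>

lemma layouts_agree:
  fixes D :: "(nat \<times> nat \<Rightarrow> 'a::unbounded_dense_linorder) set"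
  assumes "is_layout k n D \<Lambda>" "is_layout k n D \<Lambda>'" "D \<noteq> {}" "i < k" "j \<le> n i"
  shows "layer_agree (rho k n i j ` D) (\<Lambda> i j) (\<Lambda>' i j)"
proof (rule layer_agreeI)
  fix x b assume "x \<in> rho k n i j ` D"
  then have x: "x \<in> rho k n i j ` D" "x (i, j) = undefined"
    by (auto simp: rho_self)
  have "over (rho k n i j ` D) (i, j) (\<Lambda> i j) = over (rho k n i j ` D) (i, j) (\<Lambda>' i j)"
    using assms by (simp add: is_layout_def)
  moreover have "x((i, j) := b) \<in> over (rho k n i j ` D) (i, j) V \<longleftrightarrow> in_layer V x b" for V
    using x fun_upd_in_over_iff[where x = x and c = "(i, j)" and B = "rho k n i j ` D"]
    by (metis (no_types, lifting) imageE rho_self)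
  ultimately show "in_layer (\<Lambda> i j) x b \<longleftrightarrow> in_layer (\<Lambda>' i j) x b" by blast
qed (use assms in \<open>auto simp: is_layout_def\<close>)

text \<open>\<open>Cp_extension\<close> sees a function only through its values on \<open>B\<close>.
  Both sides are thus the same definite description and agree even where it is unspecified.\<close>

lemma S_cell_cong:
  assumes "\<And>x. x \<in> B \<Longrightarrow> f x = g x"
  shows "S_cell L M \<delta> I B f = S_cell L M \<delta> I B g"
proof -
  have "Cp_extension L M 1 I B f = Cp_extension L M 1 I B g"
    using assms by (auto simp: Cp_extension_def fun_eq_iff)
  then show ?thesis by (simp add: S_cell_def fun_eq_iff)
qed

section \<open>Extending a layout by one order\<close>

lemma in_layer_pullback: "in_layer (pullback \<pi> \<Lambda>) x b \<longleftrightarrow> in_layer \<Lambda> (\<pi> x) b"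
  by (cases \<Lambda>) auto

text \<open>The layer added in the successor step of \<open>extended_layout\<close>, singled out so
  that it can be compared for two layouts.\<close>

definition next_layer ::
  "('f, 'r, 'z) fo_sig_scheme \<Rightarrow> ('f, 'r, 'a::{linordered_field, linorder_topology}) fo_struct \<Rightarrow>
     ('a \<Rightarrow> 'a) \<Rightarrow> nat \<Rightarrow> (nat \<Rightarrow> nat) \<Rightarrow> 'a layout \<Rightarrow> nat \<Rightarrow> (nat \<times> nat \<Rightarrow> 'a, 'a) layer" where
  "next_layer L M \<delta> k N \<Lambda> i = (case \<Lambda> i (N i) of
      Graph f \<Rightarrow> Graph (S_cell L M \<delta> (rho_coords k N i (N i))
        (rho k N i (N i) ` layout_cell k N \<Lambda>) f)
    | Band _ _ \<Rightarrow> Band (\<lambda>_. Minf) (\<lambda>_. Pinf))"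

text \<open>A graph enters only through \<open>S_cell\<close>, hence through its values on the base,
  and every band is followed by the full band.\<close>

lemma next_layer_cong:
  assumes "layout_cell k N \<Lambda> = layout_cell k N \<Lambda>'"
    and "layer_agree (rho k N i (N i) ` layout_cell k N \<Lambda>) (\<Lambda> i (N i)) (\<Lambda>' i (N i))"
  shows "next_layer L M \<delta> k N \<Lambda> i = next_layer L M \<delta> k N \<Lambda>' i"
  using assms
  by (cases "\<Lambda> i (N i)"; cases "\<Lambda>' i (N i)") (auto simp: next_layer_def intro!: S_cell_cong)

lemma extended_layout_Suc:
  "extended_layout L M \<delta> k n \<Lambda> (Suc r) i j =
    (let N = add_ord k n r; \<Lambda>r = extended_layout L M \<delta> k n \<Lambda> r in
      if j \<le> N i then pullback (rho k N i j) (\<Lambda>r i j) else next_layer L M \<delta> k N \<Lambda>r i)"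
  by (simp add: Let_def next_layer_def)

text \<open>The pulled-back layers together say that the projection to the previous order lies in
  the previous cell; one new condition per block remains.\<close>

lemma extended_configuration_Suc:
  "extended_configuration L M \<delta> k n \<Lambda> (Suc r) =
    {x \<in> jet_space k (add_ord k n (Suc r)).
      Pi_proj k (add_ord k n r) x \<in> extended_configuration L M \<delta> k n \<Lambda> r \<and>
      (\<forall>i<k. in_layer (next_layer L M \<delta> k (add_ord k n r) (extended_layout L M \<delta> k n \<Lambda> r) i)
        (rho k (add_ord k n (Suc r)) i (Suc (n i + r)) x) (x (i, Suc (n i + r))))}"
proof -
  let ?N = "add_ord k n r" and ?N' = "add_ord k n (Suc r)"
  \<comment> \<open>The levels are nested, so projecting in two stages equals projecting
    once.\<close>
  have sub: "rho k ?N i j (rho k ?N' i j x) = rho k ?N i j x"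
    and sub': "rho k ?N i j (Pi_proj k ?N x) = rho k ?N i j x" if "i < k" for i j and x :: "nat \<times> nat \<Rightarrow> 'a"
    by (auto simp: rho_def Pi_proj_def rho_coords_def coords_def restrict_def add_ord_def fun_eq_iff)
  have N: "?N i = n i + r" "?N' i = Suc (n i + r)" if "i < k" for i
    using that by (auto simp: add_ord_def)
  have eq: "Pi_proj k ?N x (i, j) = x (i, j)" if "i < k" "j \<le> n i + r" for i j and x :: "nat \<times> nat \<Rightarrow> 'a"
    using that by (simp add: Pi_proj_def coords_def N)
  have jet: "Pi_proj k ?N x \<in> jet_space k ?N" for x :: "nat \<times> nat \<Rightarrow> 'a"
    by (simp add: Pi_proj_def jet_space_def)
  show ?thesis
    unfolding extended_configuration_def layout_cell_def
    by (auto simp: extended_layout_Suc Let_def in_layer_pullback N sub sub' eq jet le_Suc_eq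
        simp del: extended_layout.simps)
qed

lemma extended_configuration_cong:
  fixes M :: "('f, 'r, 'a::{linordered_field, linorder_topology}) fo_struct"
  assumes "is_layout k n D \<Lambda>" "is_layout k n D \<Lambda>'" "D \<subseteq> jet_space k n" "D \<noteq> {}"
    and "\<And>i. k \<le> i \<Longrightarrow> n i = 0"
  shows "extended_configuration L M \<delta> k n \<Lambda> r = extended_configuration L M \<delta> k n \<Lambda>' r"
proof -
  let ?N = "add_ord k n" and ?E = "extended_layout L M \<delta> k n"
  \<comment> \<open>\<open>add_ord\<close> vanishes from \<open>k\<close> on, as \<open>n\<close>
    does, so level 0 has exactly the order \<open>n\<close>.\<close>
  have N0: "?N 0 = n" using assms(5) by (auto simp: add_ord_def fun_eq_iff)
  \<comment> \<open>The induction also carries the agreement of the last layers over the common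
    cell, since these determine the layers added next.\<close>
  have "extended_configuration L M \<delta> k n \<Lambda> r = extended_configuration L M \<delta> k n \<Lambda>' r \<and>
    (\<forall>i<k. layer_agree (rho k (?N r) i (?N r i) ` extended_configuration L M \<delta> k n \<Lambda> r)
      (?E \<Lambda> r i (?N r i)) (?E \<Lambda>' r i (?N r i)))"
  proof (induction r)
    case 0
    have "layout_cell k n \<Lambda> = D" "layout_cell k n \<Lambda>' = D"
      using layout_cell_eq assms by blast+
    with layouts_agree[OF assms(1,2,4)] show ?case
      by (simp add: extended_configuration_def N0)
  next
    case (Suc r)
    have "next_layer L M \<delta> k (?N r) (?E \<Lambda> r) i = next_layer L M \<delta> k (?N r) (?E \<Lambda>' r) i"
      if "i < k" for i
      using Suc that by (intro next_layer_cong) (auto simp: extended_configuration_def)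
    \<comment> \<open>Hence the last layer of each block at level \<open>Suc r\<close> is the newly
      added one, not a pulled-back one.\<close>
    moreover have "\<not> ?N (Suc r) i \<le> ?N r i" if "i < k" for i
      using that by (simp add: add_ord_def)
    ultimately show ?case
      using Suc by (auto simp: extended_configuration_Suc extended_layout_Suc Let_def layer_agree_refl
          simp del: extended_layout.simps)
  qed
  then show ?thesis ..
qed

theorem theorem4p23:
  fixes L :: "('f, 'r) of_sig"
    and T :: "('f, 'r, nat) fo_form set"
    and M :: "('f, 'r, 'a::{linordered_field, linorder_topology}) fo_struct"
    and \<delta> :: "'a \<Rightarrow> 'a"
    and k p :: nat
    and C :: "(nat \<Rightarrow> 'a) set"
    and \<phi> \<psi> :: "(('f + 'a) dsym, 'r, nat) fo_form"
  assumes "o_minimal_theory L T"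
    and "models_Tg L T M \<delta>"
    and "delta_cell L M \<delta> k C"
    and "minimal_source_formula L M \<delta> k C \<phi>"
    and "minimal_source_formula L M \<delta> k C \<psi>"
    and "\<exists>ds. cell L M p (coord_list k (ord_of \<phi>)) ds (jet_set M k \<phi>)"
    and "\<exists>ds. cell L M p (coord_list k (ord_of \<psi>)) ds (jet_set M k \<psi>)"
  shows "ord_of \<phi> = ord_of \<psi> \<and>
    jet_set M k \<phi> = jet_set M k \<psi> \<and>
    jet_set M k \<psi> \<subseteq> jet_space k (ord_of \<phi>) \<and>
    (\<forall>\<Lambda> \<Lambda>'.
       minimal_layout L M \<delta> k C \<phi> \<Lambda> \<and> prepared k (ord_of \<phi>) \<Lambda> \<and>
       minimal_layout L M \<delta> k C \<psi> \<Lambda>' \<and> prepared k (ord_of \<psi>) \<Lambda>' \<longrightarrow>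
       (\<forall>m\<le>ord_of \<phi>. lower_configuration k (jet_set M k \<phi>) m =
                       lower_configuration k (jet_set M k \<psi>) m) \<and>
       (\<forall>r\<le>p. extended_configuration L M \<delta> k (ord_of \<phi>) \<Lambda> r =
               extended_configuration L M \<delta> k (ord_of \<psi>) \<Lambda>' r)) \<and>
    (\<forall>\<Lambda> \<Lambda>'. source_layout L M \<delta> k C \<phi> \<Lambda> \<and> source_layout L M \<delta> k C \<psi> \<Lambda>' \<longrightarrow>
       complete_configuration L M \<delta> p k (ord_of \<phi>) (jet_set M k \<phi>) \<Lambda> =
       complete_configuration L M \<delta> p k (ord_of \<psi>) (jet_set M k \<psi>) \<Lambda>')"
proof -
  note \<phi> = assms(4) and \<psi> = assms(5)
  have src: "source_formula L M \<delta> k C \<phi>" "source_formula L M \<delta> k C \<psi>"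
    using \<phi> \<psi> by (auto simp: minimal_source_formula_def)
  have ord: "ord_of \<psi> = ord_of \<phi>"
    using minimal_source_formulas_ord_of_eq[OF \<psi> \<phi>] .
  have jet: "jet_set M k \<psi> = jet_set M k \<phi>"
    using source_cells_eq[OF src(2,1) ord] .
  have sub: "jet_set M k \<phi> \<subseteq> jet_space k (ord_of \<phi>)"
    by (auto simp: jet_set_def)
  have ne: "jet_set M k \<phi> \<noteq> {}"
    using src(1) cell_nonempty unfolding source_formula_def by blast
  \<comment> \<open>By \<open>ord\<close> and \<open>jet\<close>, layouts belonging to the two
    formulas are layouts of one and the same cell.\<close>
  have ext: "extended_configuration L M \<delta> k (ord_of \<phi>) \<Lambda> r =
      extended_configuration L M \<delta> k (ord_of \<phi>) \<Lambda>' r"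
    if "minimal_layout L M \<delta> k C \<phi> \<Lambda>" "minimal_layout L M \<delta> k C \<psi> \<Lambda>'" for \<Lambda> \<Lambda>' r
    using that ord_of_eq_0[OF src(1)] ord jet sub ne
    by (intro extended_configuration_cong) (auto simp: minimal_layout_def)
  \<comment> \<open>After rewriting, the lower configurations are projections of literally the same
    set, and only the extended ones call for \<open>ext\<close>.\<close>
  show ?thesis
    unfolding ord jet
  proof (intro conjI allI impI)
    fix \<Lambda> \<Lambda>' assume "source_layout L M \<delta> k C \<phi> \<Lambda> \<and> source_layout L M \<delta> k C \<psi> \<Lambda>'"
    then have "minimal_layout L M \<delta> k C \<phi> \<Lambda>" "minimal_layout L M \<delta> k C \<psi> \<Lambda>'"
      by (auto simp: source_layout_def)
    from ext[OF this] show "complete_configuration L M \<delta> p k (ord_of \<phi>) (jet_set M k \<phi>) \<Lambda> =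
        complete_configuration L M \<delta> p k (ord_of \<phi>) (jet_set M k \<phi>) \<Lambda>'"
      by (simp add: complete_configuration_def)
  qed (use sub ext in auto)
qed

end
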